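(* Let $A$, $B$ and $B'$ be matrices in $\mathbb{C}^{d\times d}$. Then the Horn matrix function $G_1(A,B,B';x,y)$ satisfies the following differential formulae, where $r$ is a positive integer: (1) if $BB'=B'B$, $$\frac{\partial^r}{\partial x^r}G_1(A,B,B';x,y)=(-1)^r(A)_r\,G_1(A+rI,B-rI,B'+rI;x,y)\,(I-B)_r^{-1}(B')_r;$$ (2) if $BB'=B'B$, $$\frac{\partial^r}{\partial y^r}G_1(A,B,B';x,y)=(-1)^r(A)_r\,G_1(A+rI,B+rI,B'-rI;x,y)\,(B)_r(I-B')_r^{-1};$$ (3) $$\Big(x^2\frac{\partial}{\partial x}\Big)^r\big[x^{A+(r-1)I}G_1(A,B,B';x,xy)\big]=x^{A+rI}(A)_r\,G_1(A+rI,B,B';x,xy);$$ (4) $$\Big(y^2\frac{\partial}{\partial y}\Big)^r\big[y^{A+(r-1)I}G_1(A,B,B';xy,y)\big]=y^{A+rI}(A)_r\,G_1(A+rI,B,B';xy,y);$$ (5) $$\Big(x^2\frac{\partial}{\partial x}\Big)^r\big[G_1(A,B,B';x,\tfrac{y}{x})\,x^{B'+(r-1)I}\big]=G_1(A,B,B'+rI;x,\tfrac{y}{x})\,x^{B'+rI}(B')_r;$$ (6) $$\Big(y^2\frac{\partial}{\partial y}\Big)^r\big[G_1(A,B,B';\tfrac{x}{y},y)\,y^{B+(r-1)I}\big]=G_1(A,B+rI,B';\tfrac{x}{y},y)\,y^{B+rI}(B)_r.$$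
   Context: $G_1(A,B,B';x,y)=\sum_{m,n=0}^{\infty}(A)_{m+n}(B)_{n-m}(B')_{m-n}\frac{x^m y^n}{m!\,n!}$. Matrix Pochhammer symbol: for $M\in\mathbb{C}^{d\times d}$, $(M)_0=I$, $(M)_n=M(M+I)\cdots(M+(n-1)I)$ for $n\ge1$, and $(M)_{-n}=(-1)^n(I-M)_n^{-1}$; $(M)_n^{-1}$ is the inverse matrix of $(M)_n$. Matrix powers: $x^M=\exp(M\log x)$.
   Formalization: In (3)–(6) the weights x^{A+(r-1)I}, y^{A+(r-1)I}, x^{B'+(r-1)I}, y^{B+(r-1)I} are replaced by x^A, y^A, x^{B'}, y^B, since the printed formulae fail for r ≥ 2; (6) also assumes BB'=B'B, without which it already fails for r = 1 when A is invertible. *)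

theory Defs
  imports "HOL-Analysis.Analysis"
begin

text \<open>
  Matrices in \<open>\<complex>\<^bsup>d\<times>d\<^esup>\<close> are elements of \<open>complex^'d^'d\<close>; the product is \<open>**\<close>, and
  \<open>mat c\<close> is \<open>c I\<close>. Beware that \<open>*\<close>, \<open>1\<close> and \<open>^\<close> on this type are componentwise, so that the
  library's \<open>pochhammer\<close> cannot be used, and that the type is not an instance
  of the classes required by \<open>exp\<close>.
\<close>

definition cscale :: "complex \<Rightarrow> complex^'d^'d \<Rightarrow> complex^'d^'d"  (infixr \<open>\<odot>\<close> 75)
  where "c \<odot> M = map_matrix ((*) c) M"

definition mexp :: "complex^'d^'d \<Rightarrow> complex^'d^'d"
  where "mexp M = (\<Sum>k. (1 / fact k) *\<^sub>R (((**) M) ^^ k) (mat 1))"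

text \<open>\<open>x\<^bsup>M\<^esup>\<close>, with the principal branch of the logarithm.\<close>

definition mpow :: "complex \<Rightarrow> complex^'d^'d \<Rightarrow> complex^'d^'d"
  where "mpow x M = mexp (Ln x \<odot> M)"

primrec mpoch :: "complex^'d^'d \<Rightarrow> nat \<Rightarrow> complex^'d^'d"
  where
    "mpoch M 0 = mat 1"
  | "mpoch M (Suc n) = mpoch M n ** (M + mat (of_nat n))"

definition mpoch_int :: "complex^'d^'d \<Rightarrow> int \<Rightarrow> complex^'d^'d"
  where
    "mpoch_int M k =
      (if 0 \<le> k then mpoch M (nat k)
       else (- 1) ^ nat (- k) \<odot> matrix_inv (mpoch (mat 1 - M) (nat (- k))))"

definition horn_G1 ::
  "complex^'d^'d \<Rightarrow> complex^'d^'d \<Rightarrow> complex^'d^'d \<Rightarrow> complex \<Rightarrow> complex \<Rightarrow> complex^'d^'d"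
  where
    "horn_G1 A B B' x y =
      (\<Sum>\<^sub>\<infinity>(m, n)\<in>UNIV.
        (x ^ m * y ^ n / (fact m * fact n)) \<odot>
        (mpoch A (m + n) ** mpoch_int B (int n - int m) ** mpoch_int B' (int m - int n)))"

text \<open>
  The coefficients of \<open>G\<^sub>1(A, B, B')\<close> involve \<open>(I - B)\<^sub>n\<^bsup>-1\<^esup>\<close> and \<open>(I - B')\<^sub>n\<^bsup>-1\<^esup>\<close> for every \<open>n\<close>.
  They are meaningful only if these inverses exist
  (\<open>matrix_inv\<close> of a singular matrix is unspecified).
\<close>

definition G1_defined :: "complex^'d^'d \<Rightarrow> complex^'d^'d \<Rightarrow> bool"
  where
    "G1_defined B B' \<longleftrightarrow>
      (\<forall>n. invertible (mpoch (mat 1 - B) n) \<and> invertible (mpoch (mat 1 - B') n))"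

text \<open>The domain of convergence of the double series \<open>G\<^sub>1\<close>.\<close>

definition G1_domain :: "(complex \<times> complex) set"
  where "G1_domain = {(x, y). norm x + norm y < 1}"

text \<open>
  Differentiation is entrywise. As \<open>deriv\<close> is unspecified where a
  function is not differentiable, statements about iterates of \<open>mderiv\<close> come together with
  holomorphy, on an open set, of the function they are applied to.
\<close>

definition mderiv :: "(complex \<Rightarrow> complex^'d^'d) \<Rightarrow> complex \<Rightarrow> complex^'d^'d"
  where "mderiv F x = (\<chi> i j. deriv (\<lambda>z. F z $ i $ j) x)"

definition mholomorphic_on :: "(complex \<Rightarrow> complex^'d^'d) \<Rightarrow> complex set \<Rightarrow> bool"
    (infixl \<open>mholomorphic'_on\<close> 50)
  where "F mholomorphic_on S \<longleftrightarrow> (\<forall>i j. (\<lambda>z. F z $ i $ j) holomorphic_on S)"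

text \<open>
  The operator \<open>x\<^sup>2 d/dx\<close>. It sends \<open>x\<^bsup>M\<^esup>\<close> to \<open>M x\<^bsup>M+I\<^esup>\<close>, so its \<open>r\<close>-th iterate sends \<open>x\<^bsup>M\<^esup>\<close> to
  \<open>(M)\<^sub>r x\<^bsup>M+rI\<^esup>\<close>. Hence the formulae for the iterates carry the weight \<open>x\<^bsup>A\<^esup>\<close>; the weight
  \<open>x\<^bsup>A+(r-1)I\<^esup>\<close>, with which they are sometimes printed, agrees with it for \<open>r = 1\<close>,
  is wrong for \<open>r \<ge> 2\<close>, and belongs to the operator \<open>x\<^bsup>r+1\<^esup> d\<^sup>r/dx\<^sup>r\<close>, by
  \<open>(x\<^sup>2 d/dx)\<^sup>r = x\<^bsup>r+1\<^esup> (d\<^sup>r/dx\<^sup>r) x\<^bsup>r-1\<^esup>\<close>.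
\<close>

definition sq_mderiv :: "(complex \<Rightarrow> complex^'d^'d) \<Rightarrow> complex \<Rightarrow> complex^'d^'d"
  where "sq_mderiv F x = x\<^sup>2 \<odot> mderiv F x"

end

theory Submission
  imports Defs "HOL-Complex_Analysis.Cauchy_Integral_Formula"
begin

text \<open>
  All six formulae are iterates of a first-order identity, and each first-order identity is a
  comparison of coefficients in a double power series.

  \<^bold>\<open>Convergence.\<close> The coefficient of \<open>x\<^sup>m y\<^sup>n\<close> in \<open>G\<^sub>1(A, B, B')\<close> is
  \<open>(A)\<^bsub>m+n\<^esub> (B)\<^bsub>n-m\<^esub> (B')\<^bsub>m-n\<^esub> / (m! n!)\<close>. For every \<open>\<mu> > 1\<close> a ratio test gives
  \<open>(A)\<^sub>N = O(\<mu>\<^sup>N N!)\<close> and \<open>(I - B)\<^sub>N\<^bsup>-1\<^esup> = O(\<mu>\<^sup>N / N!)\<close>. One of the two indices \<open>n - m\<close>,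
  \<open>m - n\<close> is nonnegative and the other is its negative, so the factorials of the last two factors
  cancel and the coefficient is \<open>O(\<mu>\<^bsup>3(m+n)\<^esup> binomial(m+n, m))\<close>. As
  \<open>binomial(m+n, m) p\<^sup>m q\<^sup>n \<le> (p+q)\<^bsup>m+n\<^esup>\<close>, the series is dominated by a geometric one when
  \<open>p + q < 1\<close> (\<open>G1_summable_horn_coeff\<close>).

  \<^bold>\<open>Differentiation.\<close> Along holomorphic curves \<open>z \<mapsto> (u(z), v(z))\<close> in the domain the
  series converges locally uniformly, so by the Weierstrass theorem it may be differentiated term by term
  (\<open>dseries_deriv\<close>). In all weighted formulae \<open>u\<close> and \<open>v\<close> are monomials in \<open>z\<close>, of degrees
  \<open>s\<close> and \<open>t\<close> say, so \<open>z d/dz\<close> only multiplies the \<open>(m, n)\<close> term by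
  \<open>s m + t n\<close> (\<open>dseries_euler\<close>).

  \<^bold>\<open>First-order identities.\<close> Since \<open>z\<^sup>2 d/dz (z\<^sup>A G) = z\<^bsup>A+I\<^esup> (A G + z G')\<close>, on the line
  \<open>(\<alpha> z, \<beta> z)\<close> the coefficient is multiplied by \<open>A + (m+n) I\<close>, and
  \<open>(A)\<^sub>N (A + N I) = (A)\<^bsub>N+1\<^esub> = A (A + I)\<^sub>N\<close> turns this into the shift \<open>A \<mapsto> A + I\<close>. On the
  hyperbola \<open>(z, y/z)\<close> the weight \<open>z\<^bsup>B'\<^esup>\<close> produces \<open>B' + (m-n) I\<close>, which shifts \<open>B'\<close>
  in the same way. The derivative in \<open>x\<close> re-indexes \<open>m\<close> and shifts all three parameters. What is
  used throughout is that \<open>(M)\<^sub>k\<close> behaves like \<open>\<Gamma>(M + k I) / \<Gamma>(M)\<close> for every integer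
  \<open>k\<close>: it obeys both \<open>(M)\<^sub>k (M + k I) = (M)\<^bsub>k+1\<^esub>\<close> and \<open>M (M + I)\<^sub>k = (M)\<^bsub>k+1\<^esub>\<close>
  (\<open>mpoch_int_step\<close>, \<open>mpoch_int_step_left\<close>).

  \<^bold>\<open>Iteration and symmetry.\<close> The identities hold on open sets, so they can be iterated; the
  hypotheses on the parameters at shift \<open>0\<close> and at shift \<open>r\<close> imply those at the shifts in between
  (\<open>nonresonant_between\<close>). When \<open>B\<close> and \<open>B'\<close> commute, exchanging them exchanges the variables
  (\<open>horn_G1_swap\<close>), so the formula for \<open>y\<close> follows from that for \<open>x\<close>, and the weight
  \<open>y\<^sup>B\<close> is reduced to the weight \<open>x\<^bsup>B'\<^esup>\<close>.
\<close>

section \<open>Scalars and commuting matrices\<close>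

lemma cscale_nth [simp]: "(c \<odot> M) $ i $ j = c * M $ i $ j"
  by (simp add: cscale_def map_matrix_def)

lemma mat_nth: "mat c $ i $ j = (if i = j then c else 0)"
  by (simp add: mat_def)

lemma cscale_mult_left: "(c \<odot> M) ** N = c \<odot> (M ** N)"
  by (simp add: vec_eq_iff matrix_matrix_mult_def sum_distrib_left mult.assoc)

lemma cscale_mult_right: "M ** (c \<odot> N) = c \<odot> (M ** N)"
  by (simp add: vec_eq_iff matrix_matrix_mult_def sum_distrib_left mult_ac)

lemma cscale_cscale: "c \<odot> d \<odot> M = (c * d) \<odot> M"
  by (simp add: vec_eq_iff)

lemma cscale_add_right: "c \<odot> (M + N) = c \<odot> M + c \<odot> N"
  by (simp add: vec_eq_iff algebra_simps)

lemma cscale_one [simp]: "1 \<odot> M = M"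
  and cscale_zero [simp]: "0 \<odot> M = 0"
  by (simp_all add: vec_eq_iff)

lemma mat_eq_cscale: "mat c = c \<odot> mat 1"
  by (simp add: vec_eq_iff mat_nth)

lemma mat_mult_left: "mat c ** M = c \<odot> M"
  by (simp add: mat_eq_cscale[of c] cscale_mult_left)

lemma mat_mult_right: "M ** mat c = c \<odot> M"
  by (simp add: mat_eq_cscale[of c] cscale_mult_right)

lemma mat_add: "mat (a + b :: 'a :: monoid_add) = mat a + mat b"
  by (simp add: vec_eq_iff mat_nth)

lemma mat_diff: "mat (a - b :: 'a :: ab_group_add) = mat a - mat b"
  by (simp add: vec_eq_iff mat_nth)

lemma matrix_add_rdistrib: "(B + C) ** A = B ** A + C ** A"
  by (vector matrix_matrix_mult_def sum.distrib[symmetric] field_simps)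

lemma matrix_mult_uminus_left: "(- A) ** B = - (A ** B :: complex^'n^'m)"
  by (simp add: vec_eq_iff matrix_matrix_mult_def sum_negf)

lemma matrix_mult_uminus_right: "A ** (- B) = - (A ** B :: complex^'n^'m)"
  by (simp add: vec_eq_iff matrix_matrix_mult_def sum_negf)

lemma matrix_diff_rdistrib: "(B - C) ** A = B ** A - (C ** A :: complex^'n^'m)"
  using matrix_add_rdistrib[of B "- C" A] by (simp add: matrix_mult_uminus_left)

lemma matrix_diff_ldistrib: "A ** (B - C) = A ** B - (A ** C :: complex^'n^'m)"
  using matrix_add_ldistrib[of A B "- C"] by (simp add: matrix_mult_uminus_right)

lemma commute_add_mat:
  fixes N M :: "complex^'d^'d"
  assumes "N ** M = M ** N"
  shows "N ** (M + mat c) = (M + mat c) ** N"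
  using assms by (simp add: matrix_add_ldistrib matrix_add_rdistrib mat_mult_left mat_mult_right)

lemma commute_mat_diff:
  fixes N M :: "complex^'d^'d"
  assumes "N ** M = M ** N"
  shows "N ** (mat c - M) = (mat c - M) ** N"
  using assms by (simp add: matrix_diff_ldistrib matrix_diff_rdistrib mat_mult_left mat_mult_right)

text \<open>
  \<open>matrix_inv\<close> picks some two-sided inverse, so the defining equations are available
  exactly when one exists.
\<close>
lemma matrix_inv_props:
  fixes X :: "complex^'d^'d"
  assumes "invertible X"
  shows "X ** matrix_inv X = mat 1" "matrix_inv X ** X = mat 1"
  using someI_ex[OF assms[unfolded invertible_def]] unfolding matrix_inv_def by auto

lemma matrix_inv_eqI:
  fixes X :: "complex^'d^'d"
  assumes "X ** Y = mat 1"
  shows "matrix_inv X = Y"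
proof -
  have inv: "invertible X"
    using assms matrix_left_right_inverse invertible_def by blast
  have "matrix_inv X = matrix_inv X ** (X ** Y)" by (simp add: assms)
  also have "\<dots> = Y" by (simp add: matrix_mul_assoc matrix_inv_props[OF inv])
  finally show ?thesis .
qed

lemma invertible_mult_iff:
  fixes X Y :: "complex^'d^'d"
  shows "invertible (X ** Y) \<longleftrightarrow> invertible X \<and> invertible Y"
  by (simp add: invertible_det_nz det_mul)

lemma matrix_inv_mult:
  fixes X Y :: "complex^'d^'d"
  assumes "invertible X" "invertible Y"
  shows "matrix_inv (X ** Y) = matrix_inv Y ** matrix_inv X"
proof (rule matrix_inv_eqI)
  have "X ** Y ** (matrix_inv Y ** matrix_inv X) = X ** (Y ** matrix_inv Y) ** matrix_inv X"
    by (simp add: matrix_mul_assoc)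
  then show "X ** Y ** (matrix_inv Y ** matrix_inv X) = mat 1"
    by (simp add: matrix_inv_props assms)
qed

lemma invertible_uminus_iff:
  fixes X :: "complex^'d^'d"
  shows "invertible (- X) \<longleftrightarrow> invertible X"
  unfolding invertible_def
  by (metis matrix_mult_uminus_left matrix_mult_uminus_right minus_minus)

lemma invertible_cancel_right:
  fixes X Y Z :: "complex^'d^'d"
  assumes "invertible Z" "X ** Z = Y ** Z"
  shows "X = Y"
proof -
  have "X ** (Z ** matrix_inv Z) = Y ** (Z ** matrix_inv Z)"
    by (simp add: assms matrix_mul_assoc)
  then show ?thesis by (simp add: matrix_inv_props[OF assms(1)])
qed

lemma commute_matrix_inv:
  fixes N M :: "complex^'d^'d"
  assumes "invertible M" "N ** M = M ** N"
  shows "N ** matrix_inv M = matrix_inv M ** N"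
proof -
  have "matrix_inv M ** (N ** M) ** matrix_inv M = matrix_inv M ** (M ** N) ** matrix_inv M"
    by (simp add: assms)
  then have "(matrix_inv M ** N) ** (M ** matrix_inv M) = (matrix_inv M ** M) ** (N ** matrix_inv M)"
    by (simp only: matrix_mul_assoc)
  then show ?thesis by (simp add: matrix_inv_props[OF assms(1)])
qed

lemma commute_mult:
  fixes N M K :: "complex^'d^'d"
  assumes "N ** M = M ** N" "N ** K = K ** N"
  shows "N ** (M ** K) = (M ** K) ** N"
  by (metis assms matrix_mul_assoc)

lemma diff_mat: "M - mat c = M + mat (- c :: complex)"
  by (simp add: vec_eq_iff mat_nth)

lemma commute_add_mats:
  fixes N M :: "complex^'d^'d"
  assumes "N ** M = M ** N"
  shows "(N + mat c) ** (M + mat d) = (M + mat d) ** (N + mat c)"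
  using commute_add_mat[OF commute_add_mat[OF assms, symmetric], symmetric] by metis

lemma add_mat_of_nat_Suc: "M + mat (of_nat (Suc k)) = M + mat (of_nat k) + mat (1 :: complex)"
  and diff_mat_of_nat_Suc: "M - mat (of_nat (Suc k)) = M - mat (of_nat k) - mat (1 :: complex)"
  by (simp_all add: vec_eq_iff mat_nth)

section \<open>Pochhammer symbols of integer index\<close>

lemma commute_mpoch:
  assumes "N ** M = M ** N"
  shows "N ** mpoch M n = mpoch M n ** N"
  by (induction n) (auto intro!: commute_mult commute_add_mat assms)

text \<open>
  \<open>mpoch\<close> appends factors on the right. Splitting off the first factor instead is what links
  \<open>(M)\<^sub>n\<close> with \<open>(M + I)\<^sub>n\<close>, and hence what produces the shifts of the parameters.
\<close>
lemma mpoch_Suc_left: "mpoch M (Suc n) = M ** mpoch (M + mat 1) n"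
proof (induction n)
  case (Suc n)
  have "mpoch M (Suc (Suc n)) = M ** mpoch (M + mat 1) n ** (M + mat (of_nat (Suc n)))"
    using Suc by simp
  also have "M + mat (of_nat (Suc n)) = M + mat 1 + mat (of_nat n)"
    by (simp add: mat_add add.assoc)
  finally show ?case by (simp add: matrix_mul_assoc)
qed simp

text \<open>
  No positive integer is an eigenvalue of \<open>M\<close>; this is the condition under which the symbols
  \<open>(M)\<^bsub>-n\<^esub>\<close> of negative index make sense.
\<close>
definition nonresonant :: "complex^'d^'d \<Rightarrow> bool"
  where "nonresonant M \<longleftrightarrow> (\<forall>n. invertible (mpoch (mat 1 - M) n))"

text \<open>\<open>(I - M)\<^sub>n\<close> is, up to sign, the product of the matrices \<open>M - j I\<close> with \<open>1 \<le> j \<le> n\<close>.\<close>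
lemma nonresonant_iff: "nonresonant M \<longleftrightarrow> (\<forall>j\<ge>1. invertible (M - mat (of_nat j)))"
proof -
  have eq: "mat 1 - M + mat (of_nat n) = - (M - mat (of_nat (Suc n)))" for n
    by (simp add: mat_add)
  have "invertible (mpoch (mat 1 - M) n) \<longleftrightarrow> (\<forall>j<n. invertible (M - mat (of_nat (Suc j))))" for n
  proof (induction n)
    case 0
    show ?case by (auto simp: invertible_def intro!: exI[of _ "mat 1"])
  next
    case (Suc n)
    then show ?case
      by (auto simp only: mpoch.simps invertible_mult_iff eq invertible_uminus_iff less_Suc_eq)
  qed
  then show ?thesis unfolding nonresonant_def
    by (metis Suc_le_D One_nat_def lessI le_numeral_extra(4) Suc_le_mono le0)
qed

lemma nonresonant_diff:
  assumes "nonresonant M"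
  shows "nonresonant (M - mat (of_nat k))"
  unfolding nonresonant_iff
proof (intro allI impI)
  fix j :: nat assume "1 \<le> j"
  have "M - mat (of_nat k) - mat (of_nat j) = M - mat (of_nat (k + j))"
    by (simp add: mat_add)
  moreover have "invertible (M - mat (of_nat (k + j)))"
    using assms \<open>1 \<le> j\<close> by (simp add: nonresonant_iff del: of_nat_add)
  ultimately show "invertible (M - mat (of_nat k) - mat (of_nat j))" by (simp only:)
qed

text \<open>
  The largest shift imposes the strongest condition, so a hypothesis on it covers all the
  parameters that occur while a first-order formula is iterated.
\<close>
lemma nonresonant_between:
  assumes "nonresonant (M + mat (of_nat r))" "k \<le> r"
  shows "nonresonant (M + mat (of_nat k))"
proof -
  have "M + mat (of_nat k) = M + mat (of_nat r) - mat (of_nat (r - k))"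
    using \<open>k \<le> r\<close> by (simp add: of_nat_diff mat_diff)
  then show ?thesis using nonresonant_diff[OF assms(1), of "r - k"] by (simp only:)
qed

lemma mpoch_int_nonneg [simp]: "mpoch_int M (int n) = mpoch M n"
  by (simp add: mpoch_int_def)

text \<open>
  For \<open>n = 0\<close> the definition of \<open>mpoch_int\<close> takes its other branch, and both sides are \<open>I\<close>.
\<close>
lemma mpoch_int_neg: "mpoch_int M (- int n) = (- 1) ^ n \<odot> matrix_inv (mpoch (mat 1 - M) n)"
proof (cases "n = 0")
  case True
  then show ?thesis by (simp add: mpoch_int_def matrix_inv_eqI)
qed (simp add: mpoch_int_def)

lemma mpoch_int_zero: "mpoch_int M 0 = mat 1"
  using mpoch_int_nonneg[of M 0] by simp

text \<open>
  The functional equation of \<open>\<Gamma>(M + k I) / \<Gamma>(M)\<close>. For \<open>k = -(n+1)\<close> the factor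
  \<open>M + k I\<close> is the negative of the last factor of \<open>(I - M)\<^bsub>n+1\<^esub>\<close> and cancels against its inverse.
\<close>
lemma mpoch_int_step:
  assumes "nonresonant M"
  shows "mpoch_int M k ** (M + mat (of_int k)) = mpoch_int M (k + 1)"
proof (cases "k \<ge> 0")
  case True
  then obtain n where k: "k = int n" using nonneg_int_cases by blast
  have "mpoch_int M (k + 1) = mpoch_int M (int (Suc n))" by (simp add: k add.commute)
  then show ?thesis by (simp only: mpoch_int_nonneg k mpoch.simps of_int_of_nat_eq)
next
  case False
  define n where "n = nat (- k - 1)"
  have k: "k = - int (Suc n)" "k + 1 = - int n" using False by (auto simp: n_def)
  let ?X = "mpoch (mat 1 - M) n" and ?Y = "mat 1 - M + mat (of_nat n)"
  have inv: "invertible ?X" "invertible (?X ** ?Y)"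
    using assms unfolding nonresonant_def by (metis mpoch.simps(2))+
  then have invY: "invertible ?Y" by (simp add: invertible_mult_iff)
  have Y: "M + mat (of_int k) = (-1) \<odot> ?Y"
    by (simp add: k vec_eq_iff mat_nth)
  have comm: "?Y ** matrix_inv ?X = matrix_inv ?X ** ?Y"
    by (intro commute_matrix_inv inv commute_mpoch) (metis commute_add_mat)
  have "mpoch_int M k ** (M + mat (of_int k)) =
      (- 1) ^ n \<odot> (matrix_inv ?Y ** matrix_inv ?X ** ?Y)"
    unfolding Y unfolding k mpoch_int_neg
    by (simp add: cscale_mult_left cscale_mult_right cscale_cscale matrix_inv_mult[OF inv(1) invY])
  also have "matrix_inv ?Y ** matrix_inv ?X ** ?Y = matrix_inv ?Y ** ?Y ** matrix_inv ?X"
    by (metis comm matrix_mul_assoc)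
  finally show ?thesis by (simp add: matrix_inv_props[OF invY] k mpoch_int_neg)
qed

text \<open>
  The same quotient with the factor split off on the left. Negative indices are reached by descending
  from \<open>0\<close>: multiplying both sides by \<open>M + (k+1) I\<close> reduces the claim for \<open>k\<close> to
  the claim for \<open>k + 1\<close>, and nonresonance allows the factor to be cancelled.
\<close>
lemma mpoch_int_step_left:
  assumes "nonresonant M" "nonresonant (M + mat 1)"
  shows "M ** mpoch_int (M + mat 1) k = mpoch_int M (k + 1)"
proof (cases "k \<ge> 0")
  case True
  then obtain n where k: "k = int n" using nonneg_int_cases by blast
  have "mpoch_int M (k + 1) = mpoch_int M (int (Suc n))" by (simp add: k add.commute)
  then show ?thesis by (simp only: mpoch_int_nonneg k mpoch_Suc_left)
next
  case False
  have "M ** mpoch_int (M + mat 1) (- int n) = mpoch_int M (- int n + 1)" for n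
  proof (induction n)
    case 0
    have "mpoch_int M 1 = mpoch_int M (int (Suc 0))" by simp
    also have "\<dots> = M" by (simp only: mpoch_int_nonneg) simp
    finally show ?case using mpoch_int_nonneg[of "M + mat 1" 0] by simp
  next
    case (Suc n)
    let ?k = "- int (Suc n)"
    have inv: "invertible (M + mat 1 + mat (of_int ?k))"
    proof -
      have "M + mat 1 + mat (of_int ?k) = (M + mat 1) - mat (of_nat (Suc n))"
        by (simp add: vec_eq_iff mat_nth)
      moreover have "invertible \<dots>"
        using assms(2) unfolding nonresonant_iff by (metis One_nat_def Suc_le_mono le0)
      ultimately show ?thesis by simp
    qed
    have "M ** mpoch_int (M + mat 1) ?k ** (M + mat 1 + mat (of_int ?k)) =
        M ** mpoch_int (M + mat 1) (- int n)"
      using mpoch_int_step[OF assms(2), of ?k] by (simp add: matrix_mul_assoc[symmetric])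
    also have "\<dots> = mpoch_int M (- int n + 1)" by (rule Suc)
    also have "\<dots> = mpoch_int M (?k + 1) ** (M + mat (of_int (?k + 1)))"
      using mpoch_int_step[OF assms(1), of "?k + 1"] by (simp add: add.commute)
    also have "M + mat (of_int (?k + 1)) = M + mat 1 + mat (of_int ?k)"
      by (simp add: vec_eq_iff mat_nth)
    finally show ?case by (rule invertible_cancel_right[OF inv])
  qed
  from this[of "nat (- k)"] False show ?thesis by simp
qed

lemma commute_mpoch_int:
  assumes "nonresonant M" "N ** M = M ** N"
  shows "N ** mpoch_int M k = mpoch_int M k ** N"
proof (cases "k \<ge> 0")
  case True
  then show ?thesis using assms by (simp add: mpoch_int_def commute_mpoch)
next
  case False
  have "N ** matrix_inv (mpoch (mat 1 - M) n) = matrix_inv (mpoch (mat 1 - M) n) ** N" for n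
    using assms(1) unfolding nonresonant_def
    by (intro commute_matrix_inv commute_mpoch commute_mat_diff assms(2)) auto
  with False show ?thesis
    by (simp add: mpoch_int_def cscale_mult_left cscale_mult_right)
qed

lemma mpoch_int_neg_one_inverse:
  assumes "nonresonant M"
  shows "mpoch_int M (- 1) ** (M - mat 1) = mat 1"
proof -
  have "M + mat (of_int (- 1)) = M - mat 1" by (simp add: vec_eq_iff mat_nth)
  then show ?thesis
    using mpoch_int_step[OF assms, of "- 1"] mpoch_int_nonneg[of M 0] by simp
qed

text \<open>
  \<open>\<Gamma>(M + (k-1) I) / \<Gamma>(M)\<close>, factored through \<open>\<Gamma>(M - I)\<close>.
\<close>
lemma mpoch_int_lower:
  assumes "nonresonant M"
  shows "mpoch_int (M - mat 1) k ** mpoch_int M (- 1) = mpoch_int M (k - 1)"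
proof -
  have nr: "nonresonant (M - mat 1)" using nonresonant_diff[OF assms, of 1] by simp
  have "mpoch_int M (- 1) ** (M - mat 1) ** mpoch_int M (k - 1) =
      mpoch_int M (- 1) ** mpoch_int (M - mat 1) k"
    using mpoch_int_step_left[of "M - mat 1" "k - 1"] nr assms by (simp add: matrix_mul_assoc[symmetric])
  moreover have "mpoch_int M (- 1) ** mpoch_int (M - mat 1) k = mpoch_int (M - mat 1) k ** mpoch_int M (- 1)"
  proof (rule commute_mpoch_int[OF nr])
    have "(M - mat 1) ** mpoch_int M (- 1) = mpoch_int M (- 1) ** (M - mat 1)"
      by (rule commute_mpoch_int[OF assms]) (simp add: matrix_diff_ldistrib matrix_diff_rdistrib)
    then show "mpoch_int M (- 1) ** (M - mat 1) = (M - mat 1) ** mpoch_int M (- 1)" by simp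
  qed
  ultimately show ?thesis by (simp add: mpoch_int_neg_one_inverse[OF assms])
qed

text \<open>Here the quotient is factored through \<open>\<Gamma>(M - n I)\<close>; this is how the right-hand
  factors accumulate when the \<open>x\<close>-derivative is iterated.\<close>
lemma mpoch_int_neg_Suc:
  assumes "nonresonant M"
  shows "mpoch_int M (- int n) ** mpoch_int (M - mat (of_nat n)) (- 1) = mpoch_int M (- int (Suc n))"
proof -
  let ?R = "mpoch_int (M - mat (of_nat n)) (- 1)" and ?X = "M - mat (of_nat n) - mat 1"
  have RX: "?R ** ?X = mat 1"
    by (rule mpoch_int_neg_one_inverse[OF nonresonant_diff[OF assms]])
  have "M + mat (of_int (- int (Suc n))) = ?X" by (simp add: vec_eq_iff mat_nth)
  then have "mpoch_int M (- int n) = mpoch_int M (- int (Suc n)) ** ?X"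
    using mpoch_int_step[OF assms, of "- int (Suc n)"] by (simp only:) simp
  moreover have "?X ** ?R = mat 1" using RX matrix_left_right_inverse by blast
  ultimately show ?thesis by (simp only: matrix_mul_assoc[symmetric]) simp
qed

section \<open>Norms and entrywise differentiation\<close>

lemma bounded_bilinear_matrix_mult:
  "bounded_bilinear ((**) :: complex^'d^'d \<Rightarrow> complex^'d^'d \<Rightarrow> complex^'d^'d)"
  unfolding bilinear_conv_bounded_bilinear[symmetric] bilinear_def
  by (intro conjI allI linearI) (simp_all only: matrix_add_ldistrib matrix_add_rdistrib
      scalar_matrix_assoc matrix_scalar_ac)

text \<open>
  The euclidean norm with an unspecified constant suffices: all the growth estimates below tolerate
  the replacement of a parameter norm \<open>\<parallel>A\<parallel>\<close> by a multiple of it.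
\<close>
lemma norm_matrix_mult_le:
  "\<exists>K>0. \<forall>X Y. norm ((X :: complex^'d^'d) ** (Y :: complex^'d^'d)) \<le> norm X * norm Y * K"
  by (rule bounded_bilinear.pos_bounded[OF bounded_bilinear_matrix_mult])

lemmas bounded_linear_mult_right = bounded_bilinear.bounded_linear_right[OF bounded_bilinear_matrix_mult]
lemmas bounded_linear_mult_left = bounded_bilinear.bounded_linear_left[OF bounded_bilinear_matrix_mult]

lemma bounded_linear_entry:
  "bounded_linear (\<lambda>M :: complex^'d^'d. M $ i $ j)"
  by (rule bounded_linear_compose[OF bounded_linear_vec_nth bounded_linear_vec_nth])

lemma norm_entry_le: "norm (M $ i $ j) \<le> norm (M :: complex^'d^'d)"
  by (rule order_trans[OF Finite_Cartesian_Product.norm_nth_le Finite_Cartesian_Product.norm_nth_le])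

lemma norm_cscale [simp]: "norm (c \<odot> M) = norm c * norm M"
proof -
  have row: "norm ((c \<odot> M) $ i) = norm c * norm (M $ i)" for i
    unfolding norm_vec_def by (simp only: cscale_nth norm_mult L2_set_right_distrib[OF norm_ge_zero])
  show ?thesis
    unfolding norm_vec_def[of M] norm_vec_def[of "c \<odot> M"] row
    by (simp only: L2_set_right_distrib[OF norm_ge_zero])
qed

lemma bounded_linear_cscale: "bounded_linear (\<lambda>M. c \<odot> M)"
  using bounded_linear_mult_right[of "mat c"] by (simp add: mat_mult_left)

text \<open>
  The relational counterpart of \<open>mderiv\<close>, which asserts differentiability as well.
\<close>
definition has_mderiv :: "(complex \<Rightarrow> complex^'d^'d) \<Rightarrow> complex^'d^'d \<Rightarrow> complex \<Rightarrow> bool"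
  where "has_mderiv F D z \<longleftrightarrow>
    (\<forall>i j. ((\<lambda>w. F w $ i $ j) has_field_derivative D $ i $ j) (at z))"

lemma mderiv_eqI: "has_mderiv F D z \<Longrightarrow> mderiv F z = D"
  by (simp add: has_mderiv_def mderiv_def vec_eq_iff DERIV_imp_deriv)

lemma mholomorphic_onI:
  assumes "\<And>z. z \<in> S \<Longrightarrow> \<exists>D. has_mderiv F D z"
  shows "F mholomorphic_on S"
  unfolding mholomorphic_on_def holomorphic_on_def
proof (intro allI ballI)
  fix i j z assume "z \<in> S"
  then obtain D where "has_mderiv F D z" using assms by blast
  then have "((\<lambda>w. F w $ i $ j) has_field_derivative D $ i $ j) (at z)"
    by (simp add: has_mderiv_def)
  then show "(\<lambda>w. F w $ i $ j) field_differentiable at z within S"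
    using field_differentiable_def field_differentiable_at_within by blast
qed

lemma has_mderiv_mult:
  assumes "has_mderiv F D z" "has_mderiv G E z"
  shows "has_mderiv (\<lambda>w. F w ** G w) (D ** G z + F z ** E) z"
  unfolding has_mderiv_def
proof (intro allI)
  fix i j
  have "((\<lambda>w. \<Sum>k\<in>UNIV. F w $ i $ k * G w $ k $ j) has_field_derivative
      (\<Sum>k\<in>UNIV. D $ i $ k * G z $ k $ j + E $ k $ j * F z $ i $ k)) (at z)"
    using assms unfolding has_mderiv_def by (intro DERIV_sum DERIV_mult) auto
  then show "((\<lambda>w. (F w ** G w) $ i $ j) has_field_derivative (D ** G z + F z ** E) $ i $ j) (at z)"
    by (simp add: matrix_matrix_mult_def sum.distrib mult.commute)
qed

lemma has_mderiv_const: "has_mderiv (\<lambda>w. C) 0 z"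
  by (simp add: has_mderiv_def)

lemma has_mderiv_cmult_left:
  "has_mderiv F D z \<Longrightarrow> has_mderiv (\<lambda>w. C ** F w) (C ** D) z"
  using has_mderiv_mult[OF has_mderiv_const[of C z], of F D]
  by (simp add: bounded_bilinear.zero_left[OF bounded_bilinear_matrix_mult])

lemma has_mderiv_cmult_right:
  "has_mderiv F D z \<Longrightarrow> has_mderiv (\<lambda>w. F w ** C) (D ** C) z"
  using has_mderiv_mult[OF _ has_mderiv_const[of C z], of F D]
  by (simp add: bounded_bilinear.zero_right[OF bounded_bilinear_matrix_mult])

lemma has_mderiv_transform:
  assumes "has_mderiv G D z" "open S" "z \<in> S" "\<And>w. w \<in> S \<Longrightarrow> F w = G w"
  shows "has_mderiv F D z"
  unfolding has_mderiv_def
proof (intro allI)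
  fix i j
  have "((\<lambda>w. G w $ i $ j) has_field_derivative D $ i $ j) (at z)"
    using assms(1) by (simp add: has_mderiv_def)
  then show "((\<lambda>w. F w $ i $ j) has_field_derivative D $ i $ j) (at z)"
    by (rule has_field_derivative_transform_within_open[OF _ assms(2,3)]) (simp add: assms(4))
qed

text \<open>
  The inductive hypothesis is an equality of functions on \<open>S\<close> only, and it can be differentiated
  because \<open>S\<close> is open. The factor \<open>c\<close> serves both operators: it is \<open>1\<close> for \<open>d/dz\<close> and
  \<open>z\<^sup>2\<close> for \<open>z\<^sup>2 d/dz\<close>.
\<close>
lemma iterate_mderiv:
  assumes "open S" "z \<in> S"
    and step: "\<And>k z. k < r \<Longrightarrow> z \<in> S \<Longrightarrow> \<exists>D. has_mderiv (F k) D z \<and> c z \<odot> D = F (Suc k) z"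
  shows "((\<lambda>G z. c z \<odot> mderiv G z) ^^ r) (F 0) z = F r z"
proof -
  have "n \<le> r \<Longrightarrow> z \<in> S \<Longrightarrow> ((\<lambda>G z. c z \<odot> mderiv G z) ^^ n) (F 0) z = F n z" for n z
  proof (induction n arbitrary: z)
    case (Suc n)
    obtain D where D: "has_mderiv (F n) D z" "c z \<odot> D = F (Suc n) z"
      using step[of n z] Suc.prems by auto
    have "has_mderiv (((\<lambda>G z. c z \<odot> mderiv G z) ^^ n) (F 0)) D z"
      using Suc.prems Suc.IH by (intro has_mderiv_transform[OF D(1) \<open>open S\<close> \<open>z \<in> S\<close>]) simp_all
    then show ?case using D(2) by (simp add: mderiv_eqI)
  qed simp
  then show ?thesis using assms(2) by simp
qed

lemma sq_mderiv_power: "sq_mderiv ^^ r = (\<lambda>G z. z\<^sup>2 \<odot> mderiv G z) ^^ r"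
  by (rule arg_cong[of _ _ "\<lambda>f. f ^^ r"]) (simp add: fun_eq_iff sq_mderiv_def)

section \<open>Matrix exponentials and powers\<close>

abbreviation matpow :: "complex^'d^'d \<Rightarrow> nat \<Rightarrow> complex^'d^'d"
  where "matpow M k \<equiv> ((**) M ^^ k) (mat 1)"

lemma matpow_cscale: "matpow (t \<odot> M) k = t ^ k \<odot> matpow M k"
  by (induction k) (simp_all add: cscale_mult_left cscale_mult_right cscale_cscale)

lemma cscale_scaleR: "c \<odot> (r *\<^sub>R M) = r *\<^sub>R (c \<odot> M)"
  by (simp add: vec_eq_iff)

lemma exp_series_summable:
  fixes M :: "complex^'d^'d"
  shows "summable (\<lambda>k. norm ((1 / fact k) *\<^sub>R matpow M k))"
proof -
  obtain K where K: "K > 0" "\<And>X Y. norm ((X :: complex^'d^'d) ** (Y :: complex^'d^'d)) \<le> norm X * norm Y * K"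
    by (metis norm_matrix_mult_le)
  let ?q = "norm M * K" and ?I = "mat 1 :: complex^'d^'d"
  have pow: "norm (matpow M k) \<le> norm ?I * ?q ^ k" for k
  proof (induction k)
    case (Suc k)
    have "norm (matpow M (Suc k)) \<le> norm M * norm (matpow M k) * K" using K(2) by simp
    also have "\<dots> \<le> norm M * (norm ?I * ?q ^ k) * K"
      using Suc K(1) by (intro mult_right_mono mult_left_mono) auto
    finally show ?case by (simp add: mult_ac)
  qed simp
  show ?thesis
  proof (rule summable_comparison_test', rule summable_mult)
    show "summable (\<lambda>k. ?q ^ k /\<^sub>R fact k)" by (rule summable_exp_generic)
    fix k :: nat
    show "norm (norm ((1 / fact k) *\<^sub>R matpow M k)) \<le> norm ?I * (?q ^ k /\<^sub>R fact k)"
      using pow[of k] by (simp add: field_simps)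
  qed
qed

lemmas exp_series_summable' = summable_norm_cancel[OF exp_series_summable]

text \<open>
  Entry by entry, \<open>mexp (t \<odot> M)\<close> is a scalar power series in \<open>t\<close>, to which the theory of
  termwise differentiation applies.
\<close>
lemma mexp_entry_sums:
  "mexp (t \<odot> M) $ i $ j = (\<Sum>k. (matpow M k $ i $ j / fact k) * t ^ k)"
  and mexp_entry_summable: "summable (\<lambda>k. (matpow M k $ i $ j / fact k) * t ^ k)"
proof -
  have eq: "((1 / fact k) *\<^sub>R matpow (t \<odot> M) k) $ i $ j = (matpow M k $ i $ j / fact k) * t ^ k" for k
    by (simp add: matpow_cscale scaleR_conv_of_real[where 'a = complex])
  show "mexp (t \<odot> M) $ i $ j = (\<Sum>k. (matpow M k $ i $ j / fact k) * t ^ k)"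
    unfolding mexp_def eq[symmetric]
    by (rule bounded_linear.suminf[OF bounded_linear_entry exp_series_summable'])
  show "summable (\<lambda>k. (matpow M k $ i $ j / fact k) * t ^ k)"
    unfolding eq[symmetric]
    by (rule bounded_linear.summable[OF bounded_linear_entry exp_series_summable'])
qed

lemma commute_mexp:
  assumes "N ** M = M ** N"
  shows "N ** mexp (t \<odot> M) = mexp (t \<odot> M) ** N"
proof -
  have comm: "N ** matpow M k = matpow M k ** N" for k
    by (induction k) (auto intro!: commute_mult assms)
  have "N ** mexp (t \<odot> M) = (\<Sum>k. N ** ((1 / fact k) *\<^sub>R matpow (t \<odot> M) k))"
    unfolding mexp_def by (rule bounded_linear.suminf[OF bounded_linear_mult_right exp_series_summable'])
  also have "\<dots> = (\<Sum>k. ((1 / fact k) *\<^sub>R matpow (t \<odot> M) k) ** N)"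
    by (simp add: matpow_cscale comm cscale_scaleR matrix_scalar_ac scalar_matrix_assoc[symmetric]
        cscale_mult_left cscale_mult_right)
  also have "\<dots> = mexp (t \<odot> M) ** N"
    unfolding mexp_def
    by (rule bounded_linear.suminf[OF bounded_linear_mult_left exp_series_summable', symmetric])
  finally show ?thesis .
qed

lemma has_mderiv_mexp: "has_mderiv (\<lambda>t. mexp (t \<odot> M)) (M ** mexp (t \<odot> M)) t"
  unfolding has_mderiv_def
proof (intro allI)
  fix i j
  let ?c = "\<lambda>i k. matpow M k $ i $ j / fact k"
  have "((\<lambda>t. \<Sum>k. ?c i k * t ^ k) has_field_derivative (\<Sum>k. diffs (?c i) k * t ^ k)) (at t)"
    by (rule termdiffs_strong_converges_everywhere[OF mexp_entry_summable])
  also have "(\<lambda>k. diffs (?c i) k * t ^ k) = (\<lambda>k. \<Sum>l\<in>UNIV. M $ i $ l * (?c l k * t ^ k))"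
  proof
    fix k
    have "diffs (?c i) k = matpow M (Suc k) $ i $ j / fact k"
      by (simp add: diffs_def del: funpow.simps of_nat_Suc)
    then show "diffs (?c i) k * t ^ k = (\<Sum>l\<in>UNIV. M $ i $ l * (?c l k * t ^ k))"
      by (simp add: matrix_matrix_mult_def sum_divide_distrib sum_distrib_right mult.assoc)
  qed
  also have "(\<Sum>k. \<Sum>l\<in>UNIV. M $ i $ l * (?c l k * t ^ k)) =
      (\<Sum>l\<in>UNIV. \<Sum>k. M $ i $ l * (?c l k * t ^ k))"
    by (rule suminf_sum) (intro summable_mult mexp_entry_summable)
  also have "\<dots> = (M ** mexp (t \<odot> M)) $ i $ j"
    by (simp only: suminf_mult[OF mexp_entry_summable] mexp_entry_sums matrix_matrix_mult_def vec_lambda_beta)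
  finally show "((\<lambda>t. mexp (t \<odot> M) $ i $ j) has_field_derivative (M ** mexp (t \<odot> M)) $ i $ j) (at t)"
    by (simp add: mexp_entry_sums)
qed

lemma has_mderiv_compose:
  assumes "has_mderiv F D (g z)" "(g has_field_derivative g') (at z)"
  shows "has_mderiv (\<lambda>w. F (g w)) (g' \<odot> D) z"
  unfolding has_mderiv_def
proof (intro allI)
  fix i j
  have "((\<lambda>w. F w $ i $ j) has_field_derivative D $ i $ j) (at (g z))"
    using assms(1) by (simp add: has_mderiv_def)
  from DERIV_chain2[OF this assms(2)]
  show "((\<lambda>w. F (g w) $ i $ j) has_field_derivative (g' \<odot> D) $ i $ j) (at z)"
    by (simp add: mult.commute)
qed

lemma has_mderiv_scale:
  assumes "has_mderiv F D z" "(g has_field_derivative g') (at z)"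
  shows "has_mderiv (\<lambda>w. g w \<odot> F w) (g' \<odot> F z + g z \<odot> D) z"
  unfolding has_mderiv_def
proof (intro allI)
  fix i j
  have "((\<lambda>w. g w * F w $ i $ j) has_field_derivative (g' * F z $ i $ j + D $ i $ j * g z)) (at z)"
    using assms unfolding has_mderiv_def by (intro DERIV_mult) auto
  then show "((\<lambda>w. (g w \<odot> F w) $ i $ j) has_field_derivative (g' \<odot> F z + g z \<odot> D) $ i $ j) (at z)"
    by (simp add: mult.commute)
qed

lemma mexp_zero: "mexp (0 \<odot> M) = mat 1"
proof -
  have "mexp (0 \<odot> M) $ i $ j = mat 1 $ i $ j" for i j
    unfolding mexp_entry_sums powser_zero by simp
  then show ?thesis by (simp only: vec_eq_iff) simp
qed

lemma has_mderiv_zero_constant: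
  assumes "\<And>z. has_mderiv F 0 z"
  shows "F z = F w"
proof -
  have "F z $ i $ j = F w $ i $ j" for i j
  proof -
    have "((\<lambda>z. F z $ i $ j) has_field_derivative 0) (at z within UNIV)" for z
      using assms[of z] by (simp add: has_mderiv_def)
    then obtain c where "\<And>z. F z $ i $ j = c"
      using has_field_derivative_zero_constant[of UNIV "\<lambda>z. F z $ i $ j"] by auto
    then show ?thesis by simp
  qed
  then show ?thesis by (simp add: vec_eq_iff)
qed

text \<open>
  The functional equation \<open>e\<^bsup>t(M + c I)\<^esup> = e\<^bsup>ct\<^esup> e\<^bsup>tM\<^esup>\<close>, obtained from the uniqueness of the solution
  of a linear differential equation: \<open>e\<^bsup>-ct\<^esup> e\<^bsup>-tM\<^esup> e\<^bsup>t(M + c I)\<^esup>\<close> has derivative zero, so it is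
  always \<open>I\<close>. The case \<open>c = 0\<close> says that \<open>e\<^bsup>-tM\<^esup>\<close> is the inverse of \<open>e\<^bsup>tM\<^esup>\<close>.
\<close>
lemma mexp_shift: "mexp (t \<odot> (M + mat c)) = exp (c * t) \<odot> mexp (t \<odot> M)"
proof -
  let ?W = "\<lambda>c t. exp (- (c * t)) \<odot> (mexp ((- t) \<odot> M) ** mexp (t \<odot> (M + mat c)))"
  have W: "?W c t = mat 1" for c t
  proof -
    have "has_mderiv (?W c) 0 t" for t
    proof -
      let ?E = "mexp ((- t) \<odot> M)" and ?F = "mexp (t \<odot> (M + mat c))"
      have d1: "has_mderiv (\<lambda>t. mexp ((- t) \<odot> M)) ((- 1) \<odot> (M ** ?E)) t"
        by (rule has_mderiv_compose[OF has_mderiv_mexp]) (auto intro!: derivative_eq_intros)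
      have d2: "((\<lambda>t. exp (- (c * t))) has_field_derivative (- c * exp (- (c * t)))) (at t)"
        by (auto intro!: derivative_eq_intros)
      have ME: "M ** ?E = ?E ** M" by (rule commute_mexp) simp
      have "(- c * exp (- (c * t))) \<odot> (?E ** ?F) + exp (- (c * t)) \<odot>
          ((- 1) \<odot> (M ** ?E) ** ?F + ?E ** ((M + mat c) ** ?F)) = 0"
        unfolding ME
        by (simp add: matrix_add_ldistrib matrix_add_rdistrib matrix_mul_assoc mat_mult_right
            cscale_mult_left cscale_mult_right cscale_add_right cscale_cscale)
           (simp add: vec_eq_iff)
      then show ?thesis
        using has_mderiv_scale[OF has_mderiv_mult[OF d1 has_mderiv_mexp[of "M + mat c" t]] d2] by simp
    qed
    from has_mderiv_zero_constant[OF this, of t 0]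
    show ?thesis using mexp_zero[of M] mexp_zero[of "M + mat c"] by simp
  qed
  have inv: "mexp (t \<odot> M) ** mexp ((- t) \<odot> M) = mat 1"
    using W[of 0 "- t"] by simp
  have "mexp (t \<odot> (M + mat c)) = (exp (c * t) * exp (- (c * t))) \<odot>
      (mexp (t \<odot> M) ** mexp ((- t) \<odot> M) ** mexp (t \<odot> (M + mat c)))"
    by (simp add: inv exp_add[symmetric])
  also have "\<dots> = exp (c * t) \<odot> (mexp (t \<odot> M) ** ?W c t)"
    by (simp add: cscale_mult_right cscale_cscale matrix_mul_assoc)
  finally show ?thesis by (simp only: W matrix_mul_rid)
qed

lemma mpow_shift: "z \<noteq> 0 \<Longrightarrow> mpow z (M + mat 1) = z \<odot> mpow z M"
  using mexp_shift[of "Ln z" M 1] by (simp add: mpow_def)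

lemma commute_mpow: "N ** M = M ** N \<Longrightarrow> N ** mpow z M = mpow z M ** N"
  unfolding mpow_def by (rule commute_mexp)

lemma has_mderiv_mpow:
  assumes "z \<notin> \<real>\<^sub>\<le>\<^sub>0"
  shows "has_mderiv (\<lambda>z. mpow z M) (inverse z \<odot> (M ** mpow z M)) z"
  unfolding mpow_def
  by (rule has_mderiv_compose[OF has_mderiv_mexp]) (rule has_field_derivative_Ln[OF assms])

section \<open>Differentiating double power series\<close>

text \<open>
  The Weierstrass theorem on locally uniform limits of holomorphic functions, for unordered sums: the
  finite partial sums converge uniformly along the filter of finite sets, by the majorant \<open>M\<close>.
\<close>
lemma has_field_derivative_infsum:
  fixes f :: "'i \<Rightarrow> complex \<Rightarrow> complex"
  assumes "0 < r"
    and deriv: "\<And>i w. w \<in> cball z r \<Longrightarrow> (f i has_field_derivative f' i w) (at w)"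
    and bound: "\<And>i w. w \<in> cball z r \<Longrightarrow> norm (f i w) \<le> M i"
    and "M summable_on A"
  obtains D where "((\<lambda>w. \<Sum>\<^sub>\<infinity>i\<in>A. f i w) has_field_derivative D) (at z)"
    and "((\<lambda>i. f' i z) has_sum D) A"
proof -
  have lim: "uniform_limit (cball z r) (\<lambda>X w. \<Sum>i\<in>X. f i w) (\<lambda>w. \<Sum>\<^sub>\<infinity>i\<in>A. f i w)
      (finite_subsets_at_top A)"
    by (rule Weierstrass_m_test_general[OF bound \<open>M summable_on A\<close>])
  have "\<forall>w\<in>cball z r. ((\<lambda>w. \<Sum>i\<in>X. f i w) has_field_derivative (\<Sum>i\<in>X. f' i w)) (at w)" for X
    by (intro ballI DERIV_sum deriv)
  then have "continuous_on (cball z r) (\<lambda>w. \<Sum>i\<in>X. f i w) \<and>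
      (\<forall>w\<in>ball z r. ((\<lambda>w. \<Sum>i\<in>X. f i w) has_field_derivative (\<Sum>i\<in>X. f' i w)) (at w))" for X
    by (meson DERIV_continuous_on ball_subset_cball has_field_derivative_at_within subsetD)
  then have "\<forall>\<^sub>F X in finite_subsets_at_top A. continuous_on (cball z r) (\<lambda>w. \<Sum>i\<in>X. f i w) \<and>
      (\<forall>w\<in>ball z r. ((\<lambda>w. \<Sum>i\<in>X. f i w) has_field_derivative (\<Sum>i\<in>X. f' i w)) (at w))"
    by (rule always_eventually[OF allI])
  from has_complex_derivative_uniform_limit[OF this lim finite_subsets_at_top_neq_bot \<open>0 < r\<close>]
  obtain g' where g': "\<And>w. w \<in> ball z r \<Longrightarrow>
      ((\<lambda>w. \<Sum>\<^sub>\<infinity>i\<in>A. f i w) has_field_derivative g' w) (at w) \<and>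
      ((\<lambda>X. \<Sum>i\<in>X. f' i w) \<longlongrightarrow> g' w) (finite_subsets_at_top A)"
    by blast
  show thesis
    by (rule that[of "g' z"]) (use g'[of z] \<open>0 < r\<close> in \<open>auto simp: has_sum_def\<close>)
qed

lemma has_sum_entrywise:
  fixes f :: "'i \<Rightarrow> complex^'d^'d"
  assumes "\<And>i j. ((\<lambda>k. f k $ i $ j) has_sum S $ i $ j) A"
  shows "(f has_sum S) A"
  unfolding has_sum_def
proof (intro vec_tendstoI)
  fix i j
  have "((\<lambda>X. \<Sum>k\<in>X. f k $ i $ j) \<longlongrightarrow> S $ i $ j) (finite_subsets_at_top A)"
    using assms by (simp add: has_sum_def)
  then show "((\<lambda>X. sum f X $ i $ j) \<longlongrightarrow> S $ i $ j) (finite_subsets_at_top A)"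
    by simp
qed

definition dseries :: "(nat \<times> nat \<Rightarrow> complex^'d^'d) \<Rightarrow> complex \<Rightarrow> complex \<Rightarrow> complex^'d^'d"
  where "dseries a u v = (\<Sum>\<^sub>\<infinity>k. (u ^ fst k * v ^ snd k) \<odot> a k)"

text \<open>
  Absolute convergence of the series on the domain of \<open>G\<^sub>1\<close>, phrased for the moduli \<open>p\<close>
  and \<open>q\<close> of the variables so that it directly supplies majorants.
\<close>
definition G1_summable :: "(nat \<times> nat \<Rightarrow> complex^'d^'d) \<Rightarrow> bool"
  where "G1_summable a \<longleftrightarrow>
    (\<forall>p q. 0 \<le> p \<longrightarrow> 0 \<le> q \<longrightarrow> p + q < 1 \<longrightarrow> (\<lambda>k. p ^ fst k * q ^ snd k * norm (a k)) summable_on UNIV)"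

lemma dseries_has_sum:
  assumes "G1_summable a" "(u, v) \<in> G1_domain"
  shows "((\<lambda>k. (u ^ fst k * v ^ snd k) \<odot> a k) has_sum dseries a u v) UNIV"
  unfolding dseries_def
proof (rule has_sum_infsum, rule abs_summable_summable)
  have "(\<lambda>k. norm u ^ fst k * norm v ^ snd k * norm (a k)) summable_on UNIV"
    using assms by (auto simp: G1_summable_def G1_domain_def)
  then show "(\<lambda>k. norm ((u ^ fst k * v ^ snd k) \<odot> a k)) summable_on UNIV"
    by (simp add: norm_mult norm_power)
qed

lemma dseries_entry:
  assumes "G1_summable a" "(u, v) \<in> G1_domain"
  shows "dseries a u v $ i $ j = (\<Sum>\<^sub>\<infinity>k. u ^ fst k * v ^ snd k * a k $ i $ j)"
  using infsumI[OF has_sum_bounded_linear[OF bounded_linear_entry dseries_has_sum[OF assms], of i j]]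
  by simp

text \<open>
  Near \<open>z\<close> the moduli of \<open>u\<close> and \<open>v\<close> stay below constants \<open>p\<close> and \<open>q\<close>
  with \<open>p + q < 1\<close>, and the series at \<open>(p, q)\<close> is the majorant for termwise differentiation.
\<close>
lemma dseries_deriv:
  fixes a :: "nat \<times> nat \<Rightarrow> complex^'d^'d"
  assumes "G1_summable a" "open S" "z \<in> S"
    and dom: "\<And>w. w \<in> S \<Longrightarrow> (u w, v w) \<in> G1_domain"
    and u: "\<And>w. w \<in> S \<Longrightarrow> (u has_field_derivative u' w) (at w)"
    and v: "\<And>w. w \<in> S \<Longrightarrow> (v has_field_derivative v' w) (at w)"
  obtains D where "has_mderiv (\<lambda>w. dseries a (u w) (v w)) D z"
    and "((\<lambda>k. (of_nat (fst k) * u z ^ (fst k - 1) * u' z * v z ^ snd k +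
               u z ^ fst k * (of_nat (snd k) * v z ^ (snd k - 1) * v' z)) \<odot> a k) has_sum D) UNIV"
proof -
  \<comment> \<open>Enlarging each modulus by a third of the available room keeps the sum below \<open>1\<close>.\<close>
  define e where "e = (1 - norm (u z) - norm (v z)) / 3"
  have "e > 0" using dom[OF \<open>z \<in> S\<close>] by (simp add: e_def G1_domain_def)
  define p q where "p = norm (u z) + e" and "q = norm (v z) + e"
  have pq: "0 \<le> p" "0 \<le> q" "p + q < 1"
    using \<open>e > 0\<close> by (auto simp: p_def q_def) (auto simp: e_def field_simps)
  have "isCont (\<lambda>w. norm (u w)) z" "isCont (\<lambda>w. norm (v w)) z"
    using u[OF \<open>z \<in> S\<close>] v[OF \<open>z \<in> S\<close>] DERIV_isCont by (auto intro!: continuous_intros)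
  then have "((\<lambda>w. norm (u w)) \<longlongrightarrow> norm (u z)) (nhds z)" "((\<lambda>w. norm (v w)) \<longlongrightarrow> norm (v z)) (nhds z)"
    using tendsto_at_iff_tendsto_nhds[of "\<lambda>w. norm (u w)" z]
      tendsto_at_iff_tendsto_nhds[of "\<lambda>w. norm (v w)" z] by (simp_all only: isCont_def)
  then have "\<forall>\<^sub>F w in nhds z. norm (u w) < p" "\<forall>\<^sub>F w in nhds z. norm (v w) < q"
    using \<open>e > 0\<close> by (auto simp: p_def q_def intro!: order_tendstoD(2))
  moreover have "\<forall>\<^sub>F w in nhds z. w \<in> S"
    using assms(2,3) by (rule eventually_nhds_in_open)
  ultimately have "\<forall>\<^sub>F w in nhds z. w \<in> S \<and> norm (u w) < p \<and> norm (v w) < q"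
    by eventually_elim auto
  then obtain d where d: "d > 0" "\<And>w. dist w z < d \<Longrightarrow> w \<in> S \<and> norm (u w) < p \<and> norm (v w) < q"
    unfolding eventually_nhds_metric by blast
  define r where "r = d / 2"
  have "r > 0" using d by (simp add: r_def)
  have r: "w \<in> S" "norm (u w) \<le> p" "norm (v w) \<le> q" if "w \<in> cball z r" for w
  proof -
    have "dist w z < d" using that d(1) by (simp add: r_def dist_commute)
    from d(2)[OF this] show "w \<in> S" "norm (u w) \<le> p" "norm (v w) \<le> q" by simp_all
  qed
  let ?c = "\<lambda>w k. of_nat (fst k) * u w ^ (fst k - 1) * u' w * v w ^ snd k +
               u w ^ fst k * (of_nat (snd k) * v w ^ (snd k - 1) * v' w)"
  define P where "P i j D \<longleftrightarrow>
      ((\<lambda>w. \<Sum>\<^sub>\<infinity>k. u w ^ fst k * v w ^ snd k * a k $ i $ j) has_field_derivative D) (at z) \<and>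
      ((\<lambda>k. ?c z k * a k $ i $ j) has_sum D) UNIV" for i j D
  have "\<exists>D. P i j D" for i j
  proof -
    obtain D where "((\<lambda>w. \<Sum>\<^sub>\<infinity>k. u w ^ fst k * v w ^ snd k * a k $ i $ j) has_field_derivative D) (at z)"
      "((\<lambda>k. ?c z k * a k $ i $ j) has_sum D) UNIV"
    proof (rule has_field_derivative_infsum[OF \<open>r > 0\<close>,
          of z "\<lambda>k w. u w ^ fst k * v w ^ snd k * a k $ i $ j" "\<lambda>k w. ?c w k * a k $ i $ j"
          "\<lambda>k. p ^ fst k * q ^ snd k * norm (a k)" UNIV])
      fix k :: "nat \<times> nat" and w assume "w \<in> cball z r"
      note w = r[OF this]
      have "((\<lambda>w. u w ^ fst k * v w ^ snd k) has_field_derivative ?c w k) (at w)"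
        by (rule DERIV_cong[OF DERIV_mult'[OF DERIV_power[OF u[OF w(1)]] DERIV_power[OF v[OF w(1)]]]])
          (simp add: mult_ac add.commute)
      then show "((\<lambda>w. u w ^ fst k * v w ^ snd k * a k $ i $ j) has_field_derivative ?c w k * a k $ i $ j) (at w)"
        by (rule DERIV_cmult_right)
      show "norm (u w ^ fst k * v w ^ snd k * a k $ i $ j) \<le> p ^ fst k * q ^ snd k * norm (a k)"
        unfolding norm_mult norm_power
        by (intro mult_mono power_mono norm_entry_le w norm_ge_zero mult_nonneg_nonneg zero_le_power pq)
    next
      show "(\<lambda>k. p ^ fst k * q ^ snd k * norm (a k)) summable_on UNIV"
        using assms(1) pq by (simp add: G1_summable_def)
    qed (rule that)
    then show ?thesis unfolding P_def by (intro exI conjI)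
  qed
  then have P: "P i j (SOME D. P i j D)" for i j
    by (rule someI_ex)
  define E where "E i j = (SOME D. P i j D)" for i j
  have E: "\<And>i j. ((\<lambda>w. \<Sum>\<^sub>\<infinity>k. u w ^ fst k * v w ^ snd k * a k $ i $ j)
        has_field_derivative E i j) (at z)"
      "\<And>i j. ((\<lambda>k. ?c z k * a k $ i $ j) has_sum E i j) UNIV"
    using P unfolding P_def E_def by simp_all
  show thesis
  proof (rule that[of "\<chi> i j. E i j"])
    show "has_mderiv (\<lambda>w. dseries a (u w) (v w)) (\<chi> i j. E i j) z"
      unfolding has_mderiv_def
    proof (intro allI)
      fix i j
      show "((\<lambda>w. dseries a (u w) (v w) $ i $ j) has_field_derivative (\<chi> i j. E i j) $ i $ j) (at z)"
        unfolding vec_lambda_beta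
        by (rule has_field_derivative_transform_within_open[OF E(1) \<open>open S\<close> \<open>z \<in> S\<close>])
           (simp add: dseries_entry[OF assms(1) dom])
    qed
    show "((\<lambda>k. ?c z k \<odot> a k) has_sum (\<chi> i j. E i j)) UNIV"
      by (rule has_sum_entrywise) (simp only: cscale_nth vec_lambda_beta E(2))
  qed
qed

lemma power_pred_euler: "of_nat m * x ^ (m - 1) * x = of_nat m * (x :: complex) ^ m"
  by (cases m) auto

text \<open>
  If \<open>u\<close> and \<open>v\<close> satisfy the Euler equations \<open>z u' = s u\<close> and \<open>z v' = t v\<close> at
  \<open>z\<close>, as powers of \<open>z\<close> of degrees \<open>s\<close> and \<open>t\<close> do, the operator \<open>z d/dz\<close> acts
  diagonally on the terms of the series.
\<close>
lemma dseries_euler: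
  fixes a :: "nat \<times> nat \<Rightarrow> complex^'d^'d"
  assumes "G1_summable a" "open S" "z \<in> S"
    and dom: "\<And>w. w \<in> S \<Longrightarrow> (u w, v w) \<in> G1_domain"
    and u: "\<And>w. w \<in> S \<Longrightarrow> (u has_field_derivative u' w) (at w)"
    and v: "\<And>w. w \<in> S \<Longrightarrow> (v has_field_derivative v' w) (at w)"
    and "z * u' z = s * u z" "z * v' z = t * v z"
  obtains D where "has_mderiv (\<lambda>w. dseries a (u w) (v w)) D z"
    and "((\<lambda>k. ((s * of_nat (fst k) + t * of_nat (snd k)) * (u z ^ fst k * v z ^ snd k)) \<odot> a k)
           has_sum z \<odot> D) UNIV"
proof -
  obtain D where D: "has_mderiv (\<lambda>w. dseries a (u w) (v w)) D z"
    "((\<lambda>k. (of_nat (fst k) * u z ^ (fst k - 1) * u' z * v z ^ snd k +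
               u z ^ fst k * (of_nat (snd k) * v z ^ (snd k - 1) * v' z)) \<odot> a k) has_sum D) UNIV"
    using dseries_deriv[OF assms(1-6)] by blast
  have eq: "z * (of_nat m * u z ^ (m - 1) * u' z * v z ^ n +
               u z ^ m * (of_nat n * v z ^ (n - 1) * v' z)) =
        (s * of_nat m + t * of_nat n) * (u z ^ m * v z ^ n)" for m n
  proof -
    have "z * (of_nat m * u z ^ (m - 1) * u' z * v z ^ n +
               u z ^ m * (of_nat n * v z ^ (n - 1) * v' z)) =
        of_nat m * u z ^ (m - 1) * (z * u' z) * v z ^ n +
               u z ^ m * (of_nat n * v z ^ (n - 1) * (z * v' z))"
      by (simp add: algebra_simps)
    also have "\<dots> = s * (of_nat m * u z ^ (m - 1) * u z) * v z ^ n +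
               u z ^ m * (t * (of_nat n * v z ^ (n - 1) * v z))"
      by (simp only: assms(7,8) mult_ac)
    finally show ?thesis by (simp only: power_pred_euler) (simp add: algebra_simps)
  qed
  show thesis
    using has_sum_bounded_linear[OF bounded_linear_cscale[of z] D(2)]
    by (intro that[OF D(1)]) (simp only: cscale_cscale eq)
qed

section \<open>Growth of the coefficients\<close>

text \<open>
  A ratio test: beyond \<open>N\<close> the quotient \<open>s n / g n\<close> decreases, and its finitely many earlier
  values are absorbed into the constant.
\<close>
lemma ratio_bound:
  fixes s g :: "nat \<Rightarrow> real"
  assumes nonneg: "\<And>n. 0 \<le> s n" and pos: "\<And>n. 0 < g n"
    and ratio: "\<And>n. N \<le> n \<Longrightarrow> s (Suc n) * g n \<le> s n * g (Suc n)"
  shows "\<exists>C>0. \<forall>n. s n \<le> C * g n"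
proof (intro exI conjI allI)
  define C where "C = 1 + (\<Sum>n\<le>N. s n / g n)"
  have sum_nonneg: "0 \<le> (\<Sum>n\<le>N. s n / g n)"
    using nonneg pos by (intro sum_nonneg divide_nonneg_pos) auto
  then show "0 < C" by (simp add: C_def)
  fix n
  have small: "s n \<le> C * g n" if "n \<le> N" for n
  proof -
    have "s n / g n \<le> (\<Sum>n\<le>N. s n / g n)"
      using that nonneg pos by (intro member_le_sum) (auto intro: divide_nonneg_pos)
    then have "s n / g n \<le> C" by (simp add: C_def)
    then show ?thesis using pos[of n] by (simp add: field_simps)
  qed
  show "s n \<le> C * g n"
  proof (cases "n \<le> N")
    case False
    then have "N \<le> n" by simp
    then show ?thesis
    proof (induction n rule: dec_induct)
      case base
      show ?case by (rule small) simp
    next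
      case (step n)
      have "s (Suc n) * g n \<le> s n * g (Suc n)" by (rule ratio) fact
      also have "\<dots> \<le> (C * g n) * g (Suc n)"
        using step.IH pos[of "Suc n"] by (intro mult_right_mono) auto
      finally have "s (Suc n) * g n \<le> (C * g (Suc n)) * g n" by (simp add: mult_ac)
      then show ?case using pos[of n] by simp
    qed
  qed (rule small)
qed

text \<open>
  The factor \<open>A + n I\<close> enlarges the norm at most by \<open>n + K \<parallel>A\<parallel>\<close>, which is
  eventually below \<open>\<mu> (n + 1)\<close>. The product \<open>mpoch A n ** (A + mat n)\<close> is expanded before
  norms are taken, because the norm of the identity matrix exceeds \<open>1\<close> in dimension two and higher.
\<close>
lemma norm_mpoch_bound:
  fixes A :: "complex^'d^'d" and \<mu> :: real
  assumes "\<mu> > 1"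
  shows "\<exists>C>0. \<forall>n. norm (mpoch A n) \<le> C * (\<mu> ^ n * fact n)"
proof -
  obtain K where K: "K > 0" "\<And>X Y. norm ((X :: complex^'d^'d) ** (Y :: complex^'d^'d)) \<le> norm X * norm Y * K"
    by (metis norm_matrix_mult_le)
  obtain N where N: "real N \<ge> norm A * K / (\<mu> - 1)" by (meson real_arch_simple)
  show ?thesis
  proof (rule ratio_bound)
    fix n assume "N \<le> n"
    have "norm A * K \<le> real N * (\<mu> - 1)" using N assms by (simp add: field_simps)
    also have "\<dots> \<le> real n * (\<mu> - 1)" using assms \<open>N \<le> n\<close> by (intro mult_right_mono) auto
    finally have le: "norm A * K + real n \<le> \<mu> * real (Suc n)" using assms by (simp add: algebra_simps)
    have "mpoch A (Suc n) = mpoch A n ** A + of_nat n \<odot> mpoch A n"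
      by (simp add: matrix_add_ldistrib mat_mult_right)
    then have "norm (mpoch A (Suc n)) \<le> norm (mpoch A n ** A) + norm (of_nat n \<odot> mpoch A n)"
      using norm_triangle_ineq by metis
    also have "\<dots> \<le> norm (mpoch A n) * norm A * K + real n * norm (mpoch A n)"
      using K(2) by (intro add_mono) auto
    also have "\<dots> = norm (mpoch A n) * (norm A * K + real n)" by (simp add: algebra_simps)
    also have "\<dots> \<le> norm (mpoch A n) * (\<mu> * real (Suc n))" using le by (intro mult_left_mono) auto
    finally have "norm (mpoch A (Suc n)) * (\<mu> ^ n * fact n) \<le>
        norm (mpoch A n) * (\<mu> * real (Suc n)) * (\<mu> ^ n * fact n)"
      using assms by (intro mult_right_mono) auto
    then show "norm (mpoch A (Suc n)) * (\<mu> ^ n * fact n) \<le> norm (mpoch A n) * (\<mu> ^ Suc n * fact (Suc n))"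
      by (simp add: mult_ac)
  qed (use assms in auto)
qed

text \<open>
  With \<open>Q\<^sub>n = (I - B)\<^sub>n\<^bsup>-1\<^esup>\<close>, the relation \<open>((n+1) I - B) Q\<^bsub>n+1\<^esub> = Q\<^sub>n\<close> reads
  \<open>(n+1) Q\<^bsub>n+1\<^esub> = Q\<^sub>n + B Q\<^bsub>n+1\<^esub>\<close>. Hence \<open>(n + 1 - K \<parallel>B\<parallel>) \<parallel>Q\<^bsub>n+1\<^esub>\<parallel> \<le> \<parallel>Q\<^sub>n\<parallel>\<close>,
  and the factor on the left is eventually at least \<open>(n+1) / \<mu>\<close>.
\<close>
lemma norm_inverse_mpoch_bound:
  fixes B :: "complex^'d^'d" and \<mu> :: real
  assumes "\<mu> > 1" "nonresonant B"
  shows "\<exists>C>0. \<forall>n. norm (matrix_inv (mpoch (mat 1 - B) n)) \<le> C * (\<mu> ^ n / fact n)"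
proof -
  obtain K where K: "K > 0" "\<And>X Y. norm ((X :: complex^'d^'d) ** (Y :: complex^'d^'d)) \<le> norm X * norm Y * K"
    by (metis norm_matrix_mult_le)
  let ?\<beta> = "norm B * K"
  obtain N where N: "real N \<ge> ?\<beta> / (1 - 1 / \<mu>)" by (meson real_arch_simple)
  define Q where "Q n = matrix_inv (mpoch (mat 1 - B) n)" for n
  have "\<exists>C>0. \<forall>n. norm (Q n) \<le> C * (\<mu> ^ n / fact n)"
  proof (rule ratio_bound)
    fix n assume "N \<le> n"
    have "?\<beta> \<le> real N * (1 - 1 / \<mu>)" using N assms by (simp add: field_simps)
    also have "\<dots> \<le> real (Suc n) * (1 - 1 / \<mu>)" using assms \<open>N \<le> n\<close> by (intro mult_right_mono) auto
    finally have le: "real (Suc n) / \<mu> \<le> real (Suc n) - ?\<beta>"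
      by (simp only: right_diff_distrib) simp
    let ?Y = "mat 1 - B + mat (of_nat n)"
    have inv: "invertible (mpoch (mat 1 - B) n)" "invertible (mpoch (mat 1 - B) n ** ?Y)"
      using assms(2) unfolding nonresonant_def by (metis mpoch.simps(2))+
    then have Y: "invertible ?Y" by (simp add: invertible_mult_iff)
    have QS: "Q (Suc n) = matrix_inv ?Y ** Q n"
      unfolding Q_def mpoch.simps by (rule matrix_inv_mult[OF inv(1) Y])
    have "of_nat (Suc n) \<odot> Q (Suc n) = ?Y ** Q (Suc n) + B ** Q (Suc n)"
      by (simp add: matrix_add_rdistrib[symmetric]) (simp add: mat_add[symmetric] mat_mult_left)
    also have "?Y ** Q (Suc n) = Q n"
      unfolding QS by (simp add: matrix_mul_assoc matrix_inv_props[OF Y])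
    finally have "norm (of_nat (Suc n) \<odot> Q (Suc n)) = norm (Q n + B ** Q (Suc n))" by simp
    then have "real (Suc n) * norm (Q (Suc n)) = norm (Q n + B ** Q (Suc n))"
      by (simp only: norm_cscale norm_of_nat)
    also have "\<dots> \<le> norm (Q n) + norm B * norm (Q (Suc n)) * K"
      using norm_triangle_ineq K(2) by (metis add_left_mono order_trans)
    finally have "(real (Suc n) - ?\<beta>) * norm (Q (Suc n)) \<le> norm (Q n)"
      by (simp add: algebra_simps)
    moreover have "real (Suc n) / \<mu> * norm (Q (Suc n)) \<le> (real (Suc n) - ?\<beta>) * norm (Q (Suc n))"
      using le by (rule mult_right_mono) simp
    ultimately have "real (Suc n) / \<mu> * norm (Q (Suc n)) \<le> norm (Q n)" by linarith
    then have "norm (Q (Suc n)) \<le> norm (Q n) * (\<mu> / real (Suc n))"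
      using assms(1) by (simp add: field_simps del: of_nat_Suc)
    then have "norm (Q (Suc n)) * (\<mu> ^ n / fact n) \<le> norm (Q n) * (\<mu> / real (Suc n)) * (\<mu> ^ n / fact n)"
      using assms(1) by (intro mult_right_mono) auto
    then show "norm (Q (Suc n)) * (\<mu> ^ n / fact n) \<le> norm (Q n) * (\<mu> ^ Suc n / fact (Suc n))"
      by (simp add: mult_ac)
  qed (use assms in auto)
  then show ?thesis by (simp add: Q_def)
qed

definition horn_coeff :: "complex^'d^'d \<Rightarrow> complex^'d^'d \<Rightarrow> complex^'d^'d \<Rightarrow> nat \<times> nat \<Rightarrow> complex^'d^'d"
  where "horn_coeff A B B' k =
    (1 / (fact (fst k) * fact (snd k))) \<odot>
      (mpoch A (fst k + snd k) ** mpoch_int B (int (snd k) - int (fst k)) **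
       mpoch_int B' (int (fst k) - int (snd k)))"

lemma horn_G1_eq_dseries: "horn_G1 A B B' x y = dseries (horn_coeff A B B') x y"
  unfolding horn_G1_def dseries_def horn_coeff_def
  by (intro infsum_cong) (auto simp: cscale_cscale)

text \<open>
  In a product of symbols with opposite indices the factorial growth of one cancels the factorial decay of
  the other.
\<close>
lemma norm_mpoch_int_pair_bound:
  fixes B B' :: "complex^'d^'d" and \<mu> :: real
  assumes "\<mu> > 1" "nonresonant B" "nonresonant B'"
  shows "\<exists>C>0. \<forall>n. norm (mpoch_int B (int n)) * norm (mpoch_int B' (- int n)) \<le> C * \<mu> ^ (2 * n)"
proof -
  obtain C1 where C1: "C1 > 0" "\<And>n. norm (mpoch B n) \<le> C1 * (\<mu> ^ n * fact n)"
    using norm_mpoch_bound[OF assms(1)] by blast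
  obtain C2 where C2: "C2 > 0" "\<And>n. norm (matrix_inv (mpoch (mat 1 - B') n)) \<le> C2 * (\<mu> ^ n / fact n)"
    using norm_inverse_mpoch_bound[OF assms(1,3)] by blast
  show ?thesis
  proof (intro exI[of _ "C1 * C2"] conjI allI)
    fix n
    have "norm (mpoch_int B (int n)) * norm (mpoch_int B' (- int n)) =
        norm (mpoch B n) * norm (matrix_inv (mpoch (mat 1 - B') n))"
      by (simp add: mpoch_int_neg norm_power)
    also have "\<dots> \<le> (C1 * (\<mu> ^ n * fact n)) * (C2 * (\<mu> ^ n / fact n))"
      using C1 assms(1) by (intro mult_mono C2(2)) auto
    also have "\<dots> = C1 * C2 * \<mu> ^ (2 * n)" by (simp add: power_mult power2_eq_square power_mult_distrib)
    finally show "norm (mpoch_int B (int n)) * norm (mpoch_int B' (- int n)) \<le> C1 * C2 * \<mu> ^ (2 * n)" .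
  qed (use C1 C2 in auto)
qed

text \<open>
  One power of \<open>\<mu>\<^bsup>m+n\<^esup>\<close> comes from \<open>(A)\<^bsub>m+n\<^esub>\<close>, and two from the pair of symbols of index
  \<open>\<plusminus>(n - m)\<close>, whose absolute value is at most \<open>m + n\<close>.
\<close>
lemma norm_horn_coeff_bound:
  fixes A B B' :: "complex^'d^'d" and \<mu> :: real
  assumes "\<mu> > 1" "nonresonant B" "nonresonant B'"
  shows "\<exists>C>0. \<forall>m n. norm (horn_coeff A B B' (m, n)) \<le> C * ((\<mu> ^ 3) ^ (m + n) * ((m + n) choose m))"
proof -
  obtain K where K: "K > 0" "\<And>X Y. norm ((X :: complex^'d^'d) ** (Y :: complex^'d^'d)) \<le> norm X * norm Y * K"
    by (metis norm_matrix_mult_le)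
  obtain C0 where C0: "C0 > 0" "\<forall>n. norm (mpoch A n) \<le> C0 * (\<mu> ^ n * fact n)"
    using norm_mpoch_bound[OF assms(1)] by blast
  obtain C1 where C1: "C1 > 0"
      "\<forall>n. norm (mpoch_int B (int n)) * norm (mpoch_int B' (- int n)) \<le> C1 * \<mu> ^ (2 * n)"
    using norm_mpoch_int_pair_bound[OF assms] by blast
  obtain C2 where C2: "C2 > 0"
      "\<forall>n. norm (mpoch_int B' (int n)) * norm (mpoch_int B (- int n)) \<le> C2 * \<mu> ^ (2 * n)"
    using norm_mpoch_int_pair_bound[OF assms(1,3,2)] by blast
  have pair: "norm (mpoch_int B (int n - int m)) * norm (mpoch_int B' (int m - int n)) \<le>
      (C1 + C2) * \<mu> ^ (2 * (m + n))" for m n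
  proof -
    have mono: "C * \<mu> ^ (2 * l) \<le> (C1 + C2) * \<mu> ^ (2 * (m + n))" if "C \<le> C1 + C2" "l \<le> m + n" for C l
      using that assms(1) C1(1) C2(1) by (intro mult_mono power_increasing) auto
    show ?thesis
    proof (cases "m \<le> n")
      case True
      then have eq: "int n - int m = int (n - m)" "int m - int n = - int (n - m)" by auto
      show ?thesis
        unfolding eq using C2(1) by (intro order_trans[OF C1(2)[rule_format] mono]) auto
    next
      case False
      then have eq: "int n - int m = - int (m - n)" "int m - int n = int (m - n)" by auto
      show ?thesis
        unfolding eq mult.commute[of "norm (mpoch_int B _)"]
        using C1(1) by (intro order_trans[OF C2(2)[rule_format] mono]) auto
    qed
  qed
  show ?thesis
  proof (intro exI[of _ "C0 * (C1 + C2) * K * K"] conjI allI)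
    show "0 < C0 * (C1 + C2) * K * K" using C0 C1 C2 K by simp
    fix m n
    let ?P = "mpoch A (m + n)" and ?X = "mpoch_int B (int n - int m)" and ?Y = "mpoch_int B' (int m - int n)"
    have "norm (?P ** ?X ** ?Y) \<le> norm (?P ** ?X) * norm ?Y * K" by (rule K)
    also have "\<dots> \<le> (norm ?P * norm ?X * K) * norm ?Y * K"
      using K by (intro mult_right_mono) auto
    also have "\<dots> = norm ?P * (norm ?X * norm ?Y) * (K * K)" by (simp add: mult_ac)
    also have "\<dots> \<le> (C0 * (\<mu> ^ (m + n) * fact (m + n))) * ((C1 + C2) * \<mu> ^ (2 * (m + n))) * (K * K)"
      by (rule mult_right_mono[OF mult_mono[OF C0(2)[rule_format] pair]]) (use C0(1) K(1) assms(1) in auto)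
    also have "\<dots> = C0 * (C1 + C2) * K * K * ((\<mu> ^ 3) ^ (m + n) * fact (m + n))"
    proof -
      have "(\<mu> ^ 3) ^ (m + n) = \<mu> ^ (m + n) * \<mu> ^ (2 * (m + n))"
        by (simp add: power_mult[symmetric] power_add[symmetric])
      then show ?thesis by (simp only: mult_ac)
    qed
    finally have "norm (?P ** ?X ** ?Y) / (fact m * fact n) \<le>
        C0 * (C1 + C2) * K * K * ((\<mu> ^ 3) ^ (m + n) * fact (m + n)) / (fact m * fact n)"
      by (rule divide_right_mono) simp
    moreover have "real ((m + n) choose m) = fact (m + n) / (fact m * fact n)"
      using binomial_fact[of m "m + n", where 'a = real] by simp
    ultimately show "norm (horn_coeff A B B' (m, n)) \<le>
        C0 * (C1 + C2) * K * K * ((\<mu> ^ 3) ^ (m + n) * real ((m + n) choose m))"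
      by (simp add: horn_coeff_def norm_divide norm_mult)
  qed
qed

lemma geometric_product_summable:
  fixes \<rho> :: real
  assumes "0 \<le> \<rho>" "\<rho> < 1"
  shows "(\<lambda>k. \<rho> ^ (fst k + snd k)) summable_on (UNIV :: (nat \<times> nat) set)"
proof -
  have geo: "(\<lambda>n. \<rho> ^ n) summable_on (UNIV :: nat set)"
    using assms by (simp add: summable_on_UNIV_nonneg_real_iff summable_geometric)
  have "(\<lambda>k. \<rho> ^ (fst k + snd k)) summable_on (UNIV \<times> UNIV :: (nat \<times> nat) set)"
  proof (rule summable_on_SigmaI)
    show "((\<lambda>n. \<rho> ^ (fst (m, n) + snd (m, n))) has_sum \<rho> ^ m * (\<Sum>\<^sub>\<infinity>n. \<rho> ^ n)) UNIV" for m :: nat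
      using has_sum_cmult_right[OF has_sum_infsum[OF geo], of "\<rho> ^ m"] by (simp add: power_add)
    show "(\<lambda>m. \<rho> ^ m * (\<Sum>\<^sub>\<infinity>n. \<rho> ^ n)) summable_on (UNIV :: nat set)"
      using geo by (rule summable_on_cmult_left)
  qed (use assms in simp)
  then show ?thesis by simp
qed

text \<open>One term of the binomial expansion of the right-hand side.\<close>
lemma binomial_term_le:
  fixes p q :: real
  assumes "0 \<le> p" "0 \<le> q"
  shows "p ^ m * q ^ n * ((m + n) choose m) \<le> (p + q) ^ (m + n)"
proof -
  have "p ^ m * q ^ n * ((m + n) choose m) = of_nat ((m + n) choose m) * p ^ m * q ^ (m + n - m)"
    by simp
  also have "\<dots> \<le> (\<Sum>k\<le>m + n. of_nat ((m + n) choose k) * p ^ k * q ^ (m + n - k))"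
    by (rule member_le_sum) (use assms in auto)
  also have "\<dots> = (p + q) ^ (m + n)" by (rule binomial_ring[symmetric])
  finally show ?thesis .
qed

text \<open>
  Since \<open>p + q < 1\<close>, some \<open>\<mu> > 1\<close> still satisfies \<open>\<mu>\<^sup>3 (p + q) < 1\<close>, and the series is
  dominated by the product of two geometric series of this ratio.
\<close>
lemma G1_summable_horn_coeff:
  fixes A B B' :: "complex^'d^'d"
  assumes "nonresonant B" "nonresonant B'"
  shows "G1_summable (horn_coeff A B B')"
  unfolding G1_summable_def
proof (intro allI impI)
  fix p q :: real assume pq: "0 \<le> p" "0 \<le> q" "p + q < 1"
  have "((\<lambda>\<mu>. \<mu> ^ 3 * (p + q)) \<longlongrightarrow> 1 ^ 3 * (p + q)) (at_right 1)"
    by (intro tendsto_intros)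
  then have "\<forall>\<^sub>F \<mu> in at_right 1. \<mu> ^ 3 * (p + q) < 1"
    using pq(3) by (intro order_tendstoD(2)) auto
  then have "\<forall>\<^sub>F \<mu> in at_right 1. 1 < \<mu> \<and> \<mu> ^ 3 * (p + q) < 1"
    using eventually_at_right_less[of "1 :: real"] by eventually_elim auto
  then obtain \<mu> where \<mu>: "1 < \<mu>" "\<mu> ^ 3 * (p + q) < 1"
    using eventually_happens'[OF trivial_limit_at_right_real] by blast
  define \<rho> where "\<rho> = \<mu> ^ 3 * (p + q)"
  obtain C where C: "C > 0"
      "\<And>m n. norm (horn_coeff A B B' (m, n)) \<le> C * ((\<mu> ^ 3) ^ (m + n) * ((m + n) choose m))"
    using norm_horn_coeff_bound[OF \<mu>(1) assms] by blast
  show "(\<lambda>k. p ^ fst k * q ^ snd k * norm (horn_coeff A B B' k)) summable_on UNIV"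
  proof (rule summable_on_comparison_test)
    show "(\<lambda>k :: nat \<times> nat. C * \<rho> ^ (fst k + snd k)) summable_on UNIV"
      using \<mu> pq by (intro summable_on_cmult_right geometric_product_summable) (auto simp: \<rho>_def)
    fix k :: "nat \<times> nat"
    obtain m n where k: "k = (m, n)" by fastforce
    have "p ^ m * q ^ n * norm (horn_coeff A B B' (m, n)) \<le>
        p ^ m * q ^ n * (C * ((\<mu> ^ 3) ^ (m + n) * ((m + n) choose m)))"
      using pq by (intro mult_left_mono C(2)) auto
    also have "\<dots> = C * (\<mu> ^ 3) ^ (m + n) * (p ^ m * q ^ n * ((m + n) choose m))"
      by (simp add: mult_ac)
    also have "\<dots> \<le> C * (\<mu> ^ 3) ^ (m + n) * (p + q) ^ (m + n)"
      using C(1) \<mu>(1) pq by (intro mult_left_mono binomial_term_le) auto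
    also have "\<dots> = C * \<rho> ^ (m + n)" by (simp only: \<rho>_def power_mult_distrib mult.assoc)
    finally show "p ^ fst k * q ^ snd k * norm (horn_coeff A B B' k) \<le> C * \<rho> ^ (fst k + snd k)"
      by (simp add: k)
    show "0 \<le> p ^ fst k * q ^ snd k * norm (horn_coeff A B B' k)" using pq by simp
  qed
qed

lemmas horn_G1_has_sum =
  dseries_has_sum[OF G1_summable_horn_coeff, folded horn_G1_eq_dseries]

section \<open>Contiguity of the coefficients\<close>

text \<open>
  \<open>(A + N I) (A)\<^sub>N = A (A + I)\<^sub>N\<close> with \<open>N = m + n\<close>; the sum on the left is what \<open>A + z d/dz\<close>
  makes of the coefficient when both variables are proportional to \<open>z\<close>.
\<close>
lemma horn_coeff_raise_A:
  "A ** horn_coeff A B B' k + of_nat (fst k + snd k) \<odot> horn_coeff A B B' k =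
   A ** horn_coeff (A + mat 1) B B' k"
proof -
  let ?N = "fst k + snd k"
  have "A ** mpoch (A + mat 1) ?N = mpoch A ?N ** (A + mat (of_nat ?N))"
    using mpoch_Suc_left[of A ?N] by simp
  also have "\<dots> = A ** mpoch A ?N + of_nat ?N \<odot> mpoch A ?N"
    by (simp only: matrix_add_ldistrib mat_mult_right commute_mpoch[OF refl])
  finally have "A ** mpoch (A + mat 1) ?N = A ** mpoch A ?N + of_nat ?N \<odot> mpoch A ?N" .
  then show ?thesis
    by (simp only: horn_coeff_def cscale_mult_right cscale_mult_left cscale_cscale matrix_mul_assoc
        matrix_add_rdistrib cscale_add_right mult.commute)
qed

text \<open>
  \<open>(B')\<^sub>k (B' + k I) = (B' + I)\<^sub>k B'\<close> with \<open>k = m - n\<close>. As \<open>(B')\<^sub>k\<close> is the last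
  factor of the coefficient, a multiplication on the right reaches it without passing \<open>A\<close>
  or \<open>B\<close>.
\<close>
lemma horn_coeff_raise_B':
  assumes "nonresonant B'" "nonresonant (B' + mat 1)"
  shows "horn_coeff A B B' k ** (B' + mat (of_nat (fst k) - of_nat (snd k))) =
   horn_coeff A B (B' + mat 1) k ** B'"
proof -
  let ?N = "int (fst k) - int (snd k)"
  have "mpoch_int B' ?N ** (B' + mat (of_int ?N)) = B' ** mpoch_int (B' + mat 1) ?N"
    by (simp only: mpoch_int_step[OF assms(1)] mpoch_int_step_left[OF assms])
  also have "\<dots> = mpoch_int (B' + mat 1) ?N ** B'"
    by (rule commute_mpoch_int[OF assms(2)]) (simp add: commute_add_mat)
  finally have "mpoch_int B' ?N ** (B' + mat (of_nat (fst k) - of_nat (snd k))) =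
      mpoch_int (B' + mat 1) ?N ** B'" by simp
  then show ?thesis
    by (simp only: horn_coeff_def cscale_mult_left matrix_mul_assoc[symmetric])
qed

text \<open>
  The derivative in \<open>x\<close> replaces the coefficient at \<open>(m, n)\<close> by \<open>m + 1\<close> times the one at
  \<open>(m + 1, n)\<close>, which moves the indices of the three symbols by \<open>1\<close>, \<open>-1\<close> and
  \<open>1\<close>. Commutativity is needed to bring the factor \<open>(B)\<^bsub>-1\<^esub>\<close>, split off in the middle, to the
  right of the symbol of \<open>B' + I\<close>.
\<close>
lemma horn_coeff_shift_x:
  fixes A B B' :: "complex^'d^'d"
  assumes comm: "B ** B' = B' ** B" and "nonresonant B" "nonresonant B'" "nonresonant (B' + mat 1)"
  shows "of_nat (Suc m) \<odot> horn_coeff A B B' (Suc m, n) =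
   A ** horn_coeff (A + mat 1) (B - mat 1) (B' + mat 1) (m, n) ** (mpoch_int B (- 1) ** B')"
proof -
  let ?k = "int m - int n"
  have eq: "int n - int (Suc m) = (int n - int m) - 1" "int (Suc m) - int n = ?k + 1" by auto
  have B: "mpoch_int B (int n - int (Suc m)) = mpoch_int (B - mat 1) (int n - int m) ** mpoch_int B (- 1)"
    unfolding eq by (simp only: mpoch_int_lower[OF assms(2)])
  have B': "mpoch_int B' (int (Suc m) - int n) = mpoch_int (B' + mat 1) ?k ** B'"
    unfolding eq mpoch_int_step_left[OF assms(3,4), symmetric]
    by (rule commute_mpoch_int[OF assms(4)]) (simp add: commute_add_mat)
  have BB': "mpoch_int B (- 1) ** mpoch_int (B' + mat 1) ?k = mpoch_int (B' + mat 1) ?k ** mpoch_int B (- 1)"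
    by (intro commute_mpoch_int assms(4) commute_add_mat)
       (rule commute_mpoch_int[OF assms(2), symmetric], rule comm[symmetric])
  have BB'_right: "Z ** mpoch_int B (- 1) ** mpoch_int (B' + mat 1) ?k =
      Z ** mpoch_int (B' + mat 1) ?k ** mpoch_int B (- 1)" for Z :: "complex^'d^'d"
    by (simp only: matrix_mul_assoc[symmetric] BB')
  have fact: "of_nat (Suc m) * (1 / (fact (Suc m) * fact n)) = (1 / (fact m * fact n) :: complex)"
    by (simp del: of_nat_Suc)
  have "of_nat (Suc m) \<odot> horn_coeff A B B' (Suc m, n) = (1 / (fact m * fact n)) \<odot>
      (mpoch A (Suc (m + n)) ** mpoch_int B (int n - int (Suc m)) ** mpoch_int B' (int (Suc m) - int n))"
    unfolding horn_coeff_def cscale_cscale fst_conv snd_conv fact by simp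
  also have "mpoch A (Suc (m + n)) ** mpoch_int B (int n - int (Suc m)) ** mpoch_int B' (int (Suc m) - int n) =
      A ** (mpoch (A + mat 1) (m + n) ** mpoch_int (B - mat 1) (int n - int m) ** mpoch_int (B' + mat 1) ?k)
        ** (mpoch_int B (- 1) ** B')"
    unfolding B B' mpoch_Suc_left by (simp only: matrix_mul_assoc BB'_right)
  finally show ?thesis by (simp add: horn_coeff_def cscale_mult_left cscale_mult_right)
qed

section \<open>The first derivative\<close>

text \<open>
  The factor \<open>mpoch_int B (-1)\<close> is \<open>-(I - B)\<^bsup>-1\<^esup>\<close>; keeping it as a symbol of index \<open>-1\<close>
  takes care of the sign \<open>(-1)\<^sup>r\<close> in the iterated formula.
\<close>
lemma horn_G1_deriv_x:
  fixes A B B' :: "complex^'d^'d"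
  assumes "B ** B' = B' ** B" "nonresonant B" "nonresonant B'" "nonresonant (B' + mat 1)"
    and "(x, y) \<in> G1_domain"
  shows "has_mderiv (\<lambda>w. horn_G1 A B B' w y)
    (A ** horn_G1 (A + mat 1) (B - mat 1) (B' + mat 1) x y ** (mpoch_int B (- 1) ** B')) x"
proof -
  let ?a = "horn_coeff A B B'" and ?b = "horn_coeff (A + mat 1) (B - mat 1) (B' + mat 1)"
  let ?R = "mpoch_int B (- 1) ** B'"
  \<comment> \<open>On this ball the first variable has modulus less than \<open>1 - norm y\<close>.\<close>
  let ?S = "ball x (1 - norm x - norm y)"
  have inj: "inj (apfst Suc :: nat \<times> nat \<Rightarrow> nat \<times> nat)" by (auto simp: inj_on_def)
  have "x \<in> ?S" using assms(5) by (simp add: G1_domain_def)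
  have dom: "(w, y) \<in> G1_domain" if "w \<in> ?S" for w
    using that norm_triangle_sub[of w x] by (simp add: G1_domain_def dist_norm norm_minus_commute)
  obtain D where D: "has_mderiv (\<lambda>w. dseries ?a w y) D x"
    "((\<lambda>k. (of_nat (fst k) * x ^ (fst k - 1) * 1 * y ^ snd k +
        x ^ fst k * (of_nat (snd k) * y ^ (snd k - 1) * 0)) \<odot> ?a k) has_sum D) UNIV"
    by (rule dseries_deriv[OF G1_summable_horn_coeff[OF assms(2,3), of A] open_ball \<open>x \<in> ?S\<close> dom
          DERIV_ident DERIV_const])
  have "nonresonant (B - mat 1)" using nonresonant_diff[OF assms(2), of 1] by simp
  then have "((\<lambda>k. (x ^ fst k * y ^ snd k) \<odot> ?b k) has_sum
      horn_G1 (A + mat 1) (B - mat 1) (B' + mat 1) x y) UNIV"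
    by (rule horn_G1_has_sum[OF _ assms(4,5)])
  from has_sum_bounded_linear[OF bounded_linear_mult_left has_sum_bounded_linear[OF bounded_linear_mult_right this]]
  have "((\<lambda>k. (x ^ fst k * y ^ snd k) \<odot> (A ** ?b k ** ?R)) has_sum
      A ** horn_G1 (A + mat 1) (B - mat 1) (B' + mat 1) x y ** ?R) UNIV"
    by (simp only: cscale_mult_left cscale_mult_right)
  also have "(\<lambda>k. (x ^ fst k * y ^ snd k) \<odot> (A ** ?b k ** ?R)) =
      (\<lambda>k. (of_nat (fst k) * x ^ (fst k - 1) * y ^ snd k) \<odot> ?a k) \<circ> apfst Suc"
  proof
    fix k :: "nat \<times> nat"
    obtain m n where k: "k = (m, n)" by fastforce
    show "(x ^ fst k * y ^ snd k) \<odot> (A ** ?b k ** ?R) =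
        ((\<lambda>k. (of_nat (fst k) * x ^ (fst k - 1) * y ^ snd k) \<odot> ?a k) \<circ> apfst Suc) k"
      unfolding k horn_coeff_shift_x[OF assms(1-4), symmetric]
      by (simp add: cscale_cscale mult_ac del: of_nat_Suc)
  qed
  finally have "((\<lambda>k. (of_nat (fst k) * x ^ (fst k - 1) * y ^ snd k) \<odot> ?a k) has_sum
      A ** horn_G1 (A + mat 1) (B - mat 1) (B' + mat 1) x y ** ?R) (range (apfst Suc))"
    by (simp only: has_sum_reindex[OF inj])
  \<comment> \<open>The terms with \<open>m = 0\<close> vanish, so the derivative is the sum over the re-indexed pairs.\<close>
  moreover have "((\<lambda>k. (of_nat (fst k) * x ^ (fst k - 1) * y ^ snd k) \<odot> ?a k) has_sum D) (range (apfst Suc))"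
  proof -
    have "((\<lambda>k. (of_nat (fst k) * x ^ (fst k - 1) * y ^ snd k) \<odot> ?a k) has_sum D) UNIV"
      using D(2) by simp
    then show ?thesis
    proof (rule has_sum_cong_neutral[THEN iffD1, rotated -1])
      fix k :: "nat \<times> nat" assume "k \<in> UNIV - range (apfst Suc)"
      moreover have "k \<in> range (apfst Suc)" if "fst k = Suc m" for m
        using that by (intro image_eqI[of _ _ "(m, snd k)"]) (auto simp: prod_eq_iff)
      ultimately have "fst k = 0" by (cases "fst k") auto
      then show "(of_nat (fst k) * x ^ (fst k - 1) * y ^ snd k) \<odot> ?a k = 0" by simp
    qed auto
  qed
  ultimately have "D = A ** horn_G1 (A + mat 1) (B - mat 1) (B' + mat 1) x y ** ?R"
    by (rule has_sum_unique[symmetric])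
  then show ?thesis using D(1) by (simp only: horn_G1_eq_dseries)
qed

text \<open>
  The product rule gives \<open>z\<^sup>2 d/dz (z\<^sup>A G) = z\<^bsup>A+I\<^esup> (A G + z G')\<close>, and the bracket is summed by
  \<open>horn_coeff_raise_A\<close>. General \<open>\<alpha>\<close> and \<open>\<beta>\<close> cover the lines \<open>(x, x y)\<close> and
  \<open>(x y, y)\<close> at once, without exchanging \<open>B\<close> and \<open>B'\<close>, which would require them to commute.
\<close>
lemma weighted_horn_G1_A_deriv:
  fixes A B B' :: "complex^'d^'d"
  assumes "nonresonant B" "nonresonant B'"
    and "z \<notin> \<real>\<^sub>\<le>\<^sub>0" "(\<alpha> * z, \<beta> * z) \<in> G1_domain"
  shows "\<exists>D. has_mderiv (\<lambda>w. mpow w A ** horn_G1 A B B' (\<alpha> * w) (\<beta> * w)) D z \<and>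
    z\<^sup>2 \<odot> D = mpow z (A + mat 1) ** A ** horn_G1 (A + mat 1) B B' (\<alpha> * z) (\<beta> * z)"
proof -
  let ?a = "horn_coeff A B B'" and ?b = "horn_coeff (A + mat 1) B B'"
  let ?u = "\<lambda>w. \<alpha> * w" and ?v = "\<lambda>w. \<beta> * w"
  let ?S = "{w. (?u w, ?v w) \<in> G1_domain}"
  let ?P = "mpow z A" and ?G = "horn_G1 A B B' (?u z) (?v z)"
  have "z \<noteq> 0" using assms(3) by auto
  then have zz: "z * z * inverse z = z" by simp
  have open_S: "open ?S"
    unfolding G1_domain_def by (simp, intro open_Collect_less continuous_intros)
  obtain D where D: "has_mderiv (\<lambda>w. dseries ?a (?u w) (?v w)) D z"
    "((\<lambda>k. ((1 * of_nat (fst k) + 1 * of_nat (snd k)) * (?u z ^ fst k * ?v z ^ snd k)) \<odot> ?a k)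
           has_sum z \<odot> D) UNIV"
  proof (rule dseries_euler[OF G1_summable_horn_coeff[OF assms(1,2), of A] open_S, of z])
    show "((\<lambda>w. \<alpha> * w) has_field_derivative \<alpha>) (at w)" for w
      by (auto intro!: derivative_eq_intros)
    show "((\<lambda>w. \<beta> * w) has_field_derivative \<beta>) (at w)" for w
      by (auto intro!: derivative_eq_intros)
  qed (use assms(4) in \<open>auto simp: mult.commute\<close>)
  have "((\<lambda>k. A ** (?u z ^ fst k * ?v z ^ snd k) \<odot> ?a k +
      ((1 * of_nat (fst k) + 1 * of_nat (snd k)) * (?u z ^ fst k * ?v z ^ snd k)) \<odot> ?a k) has_sum
      A ** ?G + z \<odot> D) UNIV"
    by (intro has_sum_add D(2) has_sum_bounded_linear[OF bounded_linear_mult_right]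
        horn_G1_has_sum assms)
  also have "(\<lambda>k. A ** (?u z ^ fst k * ?v z ^ snd k) \<odot> ?a k +
      ((1 * of_nat (fst k) + 1 * of_nat (snd k)) * (?u z ^ fst k * ?v z ^ snd k)) \<odot> ?a k) =
      (\<lambda>k. A ** ((?u z ^ fst k * ?v z ^ snd k) \<odot> ?b k))"
  proof
    fix k
    let ?c = "?u z ^ fst k * ?v z ^ snd k"
    have "A ** ?c \<odot> ?a k + ((1 * of_nat (fst k) + 1 * of_nat (snd k)) * ?c) \<odot> ?a k =
        ?c \<odot> (A ** ?a k + of_nat (fst k + snd k) \<odot> ?a k)"
      by (simp only: cscale_mult_right cscale_add_right cscale_cscale of_nat_add mult_1 mult.commute)
    then show "A ** ?c \<odot> ?a k + ((1 * of_nat (fst k) + 1 * of_nat (snd k)) * ?c) \<odot> ?a k = A ** (?c \<odot> ?b k)"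
      by (simp only: horn_coeff_raise_A cscale_mult_right)
  qed
  finally have sum: "A ** ?G + z \<odot> D = A ** horn_G1 (A + mat 1) B B' (?u z) (?v z)"
    using has_sum_bounded_linear[OF bounded_linear_mult_right horn_G1_has_sum[OF assms(1,2,4)]]
    by (rule has_sum_unique)
  have AP: "A ** ?P = ?P ** A" by (rule commute_mpow) simp
  have "has_mderiv (\<lambda>w. mpow w A ** horn_G1 A B B' (?u w) (?v w))
      (inverse z \<odot> (A ** ?P) ** ?G + ?P ** D) z"
    by (intro has_mderiv_mult has_mderiv_mpow assms D(1)[folded horn_G1_eq_dseries])
  moreover have "z\<^sup>2 \<odot> (inverse z \<odot> (A ** ?P) ** ?G + ?P ** D) = z \<odot> (?P ** (A ** ?G + z \<odot> D))"
    unfolding AP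
    by (simp add: zz cscale_add_right cscale_mult_left cscale_mult_right cscale_cscale
        matrix_add_ldistrib matrix_mul_assoc power2_eq_square)
  moreover have "z \<odot> (?P ** (A ** ?G + z \<odot> D)) =
      mpow z (A + mat 1) ** A ** horn_G1 (A + mat 1) B B' (?u z) (?v z)"
    unfolding sum mpow_shift[OF \<open>z \<noteq> 0\<close>] by (simp add: cscale_mult_left matrix_mul_assoc)
  ultimately show ?thesis by auto
qed

text \<open>
  Here \<open>z\<^sup>2 d/dz (G z\<^bsup>B'\<^esup>) = (G B' + z G') z\<^bsup>B'+I\<^esup>\<close>. On the curve \<open>(z, y/z)\<close> the variables have degrees
  \<open>1\<close> and \<open>-1\<close>, so the bracket is summed by \<open>horn_coeff_raise_B'\<close>.
\<close>
lemma weighted_horn_G1_B'_deriv: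
  fixes A B B' :: "complex^'d^'d"
  assumes "nonresonant B" "nonresonant B'" "nonresonant (B' + mat 1)"
    and "z \<notin> \<real>\<^sub>\<le>\<^sub>0" "(z, y / z) \<in> G1_domain"
  shows "\<exists>D. has_mderiv (\<lambda>w. horn_G1 A B B' w (y / w) ** mpow w B') D z \<and>
    z\<^sup>2 \<odot> D = horn_G1 A B (B' + mat 1) z (y / z) ** mpow z (B' + mat 1) ** B'"
proof -
  let ?a = "horn_coeff A B B'" and ?b = "horn_coeff A B (B' + mat 1)"
  let ?S = "{w. w \<noteq> 0 \<and> (w, y / w) \<in> G1_domain}"
  let ?P = "mpow z B'" and ?G = "horn_G1 A B B' z (y / z)"
  have "z \<noteq> 0" using assms(4) by auto
  then have zz: "z * z * inverse z = z" by simp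
  have open_S: "open ?S"
  proof -
    have "?S = - {0} \<inter> (\<lambda>w. norm w + norm (y / w)) -` {..<1}" by (auto simp: G1_domain_def)
    also have "open \<dots>" by (intro continuous_open_preimage) (auto intro!: continuous_intros)
    finally show ?thesis .
  qed
  obtain D where D: "has_mderiv (\<lambda>w. dseries ?a w (y / w)) D z"
    "((\<lambda>k. ((1 * of_nat (fst k) + (- 1) * of_nat (snd k)) * (z ^ fst k * (y / z) ^ snd k)) \<odot> ?a k)
           has_sum z \<odot> D) UNIV"
  proof (rule dseries_euler[OF G1_summable_horn_coeff[OF assms(1,2), of A] open_S, of z])
    show "((\<lambda>w. w) has_field_derivative 1) (at w)" for w :: complex
      by (rule DERIV_ident)
    show "((\<lambda>w. y / w) has_field_derivative (- y / w\<^sup>2)) (at w)" if "w \<in> ?S" for w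
      using that by (auto intro!: derivative_eq_intros simp: power2_eq_square)
    show "z * (- y / z\<^sup>2) = - 1 * (y / z)" using \<open>z \<noteq> 0\<close> by (simp add: power2_eq_square)
  qed (use assms(5) \<open>z \<noteq> 0\<close> in auto)
  have "((\<lambda>k. ((z ^ fst k * (y / z) ^ snd k) \<odot> ?a k) ** B' +
      ((1 * of_nat (fst k) + (- 1) * of_nat (snd k)) * (z ^ fst k * (y / z) ^ snd k)) \<odot> ?a k) has_sum
      ?G ** B' + z \<odot> D) UNIV"
    by (intro has_sum_add D(2) has_sum_bounded_linear[OF bounded_linear_mult_left]
        horn_G1_has_sum assms)
  also have "(\<lambda>k. ((z ^ fst k * (y / z) ^ snd k) \<odot> ?a k) ** B' +
      ((1 * of_nat (fst k) + (- 1) * of_nat (snd k)) * (z ^ fst k * (y / z) ^ snd k)) \<odot> ?a k) =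
      (\<lambda>k. ((z ^ fst k * (y / z) ^ snd k) \<odot> ?b k) ** B')"
  proof
    fix k
    let ?c = "z ^ fst k * (y / z) ^ snd k"
    have "(1 * of_nat (fst k) + (- 1) * of_nat (snd k)) = (of_nat (fst k) - of_nat (snd k) :: complex)"
      by simp
    then have "(?c \<odot> ?a k) ** B' + ((1 * of_nat (fst k) + (- 1) * of_nat (snd k)) * ?c) \<odot> ?a k =
        ?c \<odot> (?a k ** (B' + mat (of_nat (fst k) - of_nat (snd k))))"
      by (simp only: cscale_mult_left cscale_add_right cscale_cscale matrix_add_ldistrib mat_mult_right
          mult.commute)
    then show "(?c \<odot> ?a k) ** B' + ((1 * of_nat (fst k) + (- 1) * of_nat (snd k)) * ?c) \<odot> ?a k =
        (?c \<odot> ?b k) ** B'"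
      by (simp only: horn_coeff_raise_B'[OF assms(2,3)] cscale_mult_left)
  qed
  finally have sum: "?G ** B' + z \<odot> D = horn_G1 A B (B' + mat 1) z (y / z) ** B'"
    using has_sum_bounded_linear[OF bounded_linear_mult_left horn_G1_has_sum[OF assms(1,3,5)]]
    by (rule has_sum_unique)
  have BP: "B' ** ?P = ?P ** B'" by (rule commute_mpow) simp
  have "has_mderiv (\<lambda>w. horn_G1 A B B' w (y / w) ** mpow w B')
      (D ** ?P + ?G ** (inverse z \<odot> (B' ** ?P))) z"
    by (intro has_mderiv_mult has_mderiv_mpow assms D(1)[folded horn_G1_eq_dseries])
  moreover have "z\<^sup>2 \<odot> (D ** ?P + ?G ** (inverse z \<odot> (B' ** ?P))) = z \<odot> ((?G ** B' + z \<odot> D) ** ?P)"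
    by (simp add: zz cscale_add_right cscale_mult_left cscale_mult_right cscale_cscale
        matrix_add_rdistrib matrix_mul_assoc power2_eq_square add.commute)
  moreover have "z \<odot> ((?G ** B' + z \<odot> D) ** ?P) =
      horn_G1 A B (B' + mat 1) z (y / z) ** mpow z (B' + mat 1) ** B'"
    unfolding sum mpow_shift[OF \<open>z \<noteq> 0\<close>]
    by (simp add: cscale_mult_left cscale_mult_right matrix_mul_assoc[symmetric] BP)
  ultimately show ?thesis by auto
qed

section \<open>Iterated derivatives\<close>

text \<open>
  The factors that one more differentiation inserts next to the series, merged with those
  already present: \<open>(B - k I)\<^bsub>-1\<^esub>\<close> extends \<open>(B)\<^bsub>-k\<^esub>\<close>, and \<open>B' + k I\<close>
  extends \<open>(B')\<^sub>k\<close>.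
\<close>
lemma horn_G1_x_factors_step:
  fixes B B' :: "complex^'d^'d"
  assumes comm: "B ** B' = B' ** B" and "nonresonant B"
  shows "(mpoch_int (B - mat (of_nat k)) (- 1) ** (B' + mat (of_nat k))) **
      (mpoch_int B (- int k) ** mpoch B' k) = mpoch_int B (- int (Suc k)) ** mpoch B' (Suc k)"
proof -
  let ?R = "mpoch_int (B - mat (of_nat k)) (- 1)" and ?Y = "B' + mat (of_nat k)"
  let ?Q = "mpoch_int B (- int k)" and ?Z = "mpoch B' k"
  have "?Y ** ?Q = ?Q ** ?Y"
    by (rule commute_mpoch_int[OF assms(2)]) (metis comm commute_add_mat)
  moreover have "?Q ** ?R = ?R ** ?Q"
  proof (rule commute_mpoch_int[OF nonresonant_diff[OF assms(2)]])
    have "B ** ?Q = ?Q ** B" by (rule commute_mpoch_int[OF assms(2)]) simp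
    then show "?Q ** (B - mat (of_nat k)) = (B - mat (of_nat k)) ** ?Q"
      by (simp add: matrix_diff_ldistrib matrix_diff_rdistrib mat_mult_left mat_mult_right)
  qed
  moreover have "?Y ** ?Z = ?Z ** ?Y"
    by (rule commute_mpoch) (simp add: commute_add_mat)
  ultimately have "(?R ** ?Y) ** (?Q ** ?Z) = (?Q ** ?R) ** (?Z ** ?Y)"
    by (metis matrix_mul_assoc)
  then show ?thesis by (simp only: mpoch_int_neg_Suc[OF assms(2)] mpoch.simps)
qed

lemma horn_G1_x_derivatives:
  fixes A B B' :: "complex^'d^'d"
  assumes comm: "B ** B' = B' ** B" and B: "nonresonant B" and B': "nonresonant B'"
    and B'r: "nonresonant (B' + mat (of_nat r))" and "r \<ge> 1"
  shows "(\<lambda>x. horn_G1 A B B' x y) mholomorphic_on {x. (x, y) \<in> G1_domain}"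
    and "(x, y) \<in> G1_domain \<Longrightarrow> (mderiv ^^ r) (\<lambda>x. horn_G1 A B B' x y) x =
      (- 1) ^ r \<odot> (mpoch A r **
        horn_G1 (A + mat (of_nat r)) (B - mat (of_nat r)) (B' + mat (of_nat r)) x y **
        matrix_inv (mpoch (mat 1 - B) r) ** mpoch B' r)"
proof -
  define F where "F k w = mpoch A k **
      horn_G1 (A + mat (of_nat k)) (B - mat (of_nat k)) (B' + mat (of_nat k)) w y **
      (mpoch_int B (- int k) ** mpoch B' k)" for k w
  have F0: "F 0 = (\<lambda>x. horn_G1 A B B' x y)"
    by (simp add: F_def mpoch_int_zero fun_eq_iff)
  have step: "has_mderiv (F k) (F (Suc k) z) z" if "k < r" "(z, y) \<in> G1_domain" for k z
  proof -
    let ?A = "A + mat (of_nat k)" and ?B = "B - mat (of_nat k)" and ?B' = "B' + mat (of_nat k)"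
    have BB': "?B ** ?B' = ?B' ** ?B"
      unfolding diff_mat by (rule commute_add_mats[OF comm])
    have "nonresonant ?B'" "nonresonant (?B' + mat 1)"
      using nonresonant_between[OF B'r, of k] nonresonant_between[OF B'r, of "Suc k"] that
      by (simp_all only: add_mat_of_nat_Suc)
    note deriv = horn_G1_deriv_x[OF BB' nonresonant_diff[OF B] this that(2), of ?A]
    have "F (Suc k) z = mpoch A k ** (?A **
        horn_G1 (?A + mat 1) (?B - mat 1) (?B' + mat 1) z y ** (mpoch_int ?B (- 1) ** ?B')) **
        (mpoch_int B (- int k) ** mpoch B' k)"
      unfolding F_def horn_G1_x_factors_step[OF comm B, symmetric]
      unfolding add_mat_of_nat_Suc diff_mat_of_nat_Suc mpoch.simps
      by (simp only: matrix_mul_assoc)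
    then show ?thesis
      using has_mderiv_cmult_right[OF has_mderiv_cmult_left[OF deriv]] unfolding F_def by simp
  qed
  have "has_mderiv (F 0) (F (Suc 0) z) z" if "(z, y) \<in> G1_domain" for z
    by (rule step) (use that \<open>r \<ge> 1\<close> in auto)
  then show "(\<lambda>x. horn_G1 A B B' x y) mholomorphic_on {x. (x, y) \<in> G1_domain}"
    by (intro mholomorphic_onI) (auto simp: F0)
  have "open {x. (x, y) \<in> G1_domain}"
    unfolding G1_domain_def by (simp, intro open_Collect_less continuous_intros)
  then show "(mderiv ^^ r) (\<lambda>x. horn_G1 A B B' x y) x =
      (- 1) ^ r \<odot> (mpoch A r **
        horn_G1 (A + mat (of_nat r)) (B - mat (of_nat r)) (B' + mat (of_nat r)) x y **
        matrix_inv (mpoch (mat 1 - B) r) ** mpoch B' r)" if "(x, y) \<in> G1_domain"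
  proof -
    have "((\<lambda>G z. 1 \<odot> mderiv G z) ^^ r) (F 0) x = F r x"
      by (rule iterate_mderiv[OF \<open>open {x. (x, y) \<in> G1_domain}\<close>])
         (use that step in \<open>auto intro!: exI\<close>)
    then show ?thesis
      unfolding F0 unfolding F_def mpoch_int_neg
      by (simp add: cscale_mult_left cscale_mult_right matrix_mul_assoc)
  qed
qed

text \<open>
  The accumulated factor \<open>(A)\<^sub>k\<close> is a polynomial in \<open>A\<close>, so it passes through the power of \<open>z\<close>
  and stays constant under the next differentiation.
\<close>
lemma weighted_horn_G1_A_derivatives:
  fixes A B B' :: "complex^'d^'d"
  assumes "nonresonant B" "nonresonant B'"
  shows "(\<lambda>w. mpow w A ** horn_G1 A B B' (\<alpha> * w) (\<beta> * w))
      mholomorphic_on {w. w \<notin> \<real>\<^sub>\<le>\<^sub>0 \<and> (\<alpha> * w, \<beta> * w) \<in> G1_domain}"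
    and "z \<notin> \<real>\<^sub>\<le>\<^sub>0 \<Longrightarrow> (\<alpha> * z, \<beta> * z) \<in> G1_domain \<Longrightarrow>
      (sq_mderiv ^^ r) (\<lambda>w. mpow w A ** horn_G1 A B B' (\<alpha> * w) (\<beta> * w)) z =
      mpow z (A + mat (of_nat r)) ** mpoch A r ** horn_G1 (A + mat (of_nat r)) B B' (\<alpha> * z) (\<beta> * z)"
proof -
  let ?S = "{w. w \<notin> \<real>\<^sub>\<le>\<^sub>0 \<and> (\<alpha> * w, \<beta> * w) \<in> G1_domain}"
  define F where "F k w = mpow w (A + mat (of_nat k)) ** mpoch A k **
      horn_G1 (A + mat (of_nat k)) B B' (\<alpha> * w) (\<beta> * w)" for k w
  have F0: "F 0 = (\<lambda>w. mpow w A ** horn_G1 A B B' (\<alpha> * w) (\<beta> * w))"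
    by (simp add: F_def fun_eq_iff)
  have comm: "mpow w (A + mat c) ** mpoch A k = mpoch A k ** mpow w (A + mat c)" for w c k
    by (rule commute_mpow[symmetric]) (intro commute_add_mat commute_mpoch[symmetric] refl)
  have step: "\<exists>D. has_mderiv (F k) D z \<and> z\<^sup>2 \<odot> D = F (Suc k) z" if z: "z \<in> ?S" for k z
  proof -
    let ?A = "A + mat (of_nat k)"
    obtain D where D: "has_mderiv (\<lambda>w. mpow w ?A ** horn_G1 ?A B B' (\<alpha> * w) (\<beta> * w)) D z"
        "z\<^sup>2 \<odot> D = mpow z (?A + mat 1) ** ?A ** horn_G1 (?A + mat 1) B B' (\<alpha> * z) (\<beta> * z)"
      using weighted_horn_G1_A_deriv[OF assms, of z \<alpha> \<beta> ?A] z by auto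
    have "F k = (\<lambda>w. mpoch A k ** (mpow w ?A ** horn_G1 ?A B B' (\<alpha> * w) (\<beta> * w)))"
      by (rule ext) (simp only: F_def comm matrix_mul_assoc)
    then have "has_mderiv (F k) (mpoch A k ** D) z"
      using has_mderiv_cmult_left[OF D(1)] by simp
    moreover have "z\<^sup>2 \<odot> (mpoch A k ** D) = F (Suc k) z"
    proof -
      have "z\<^sup>2 \<odot> (mpoch A k ** D) = mpoch A k ** mpow z (A + mat (of_nat (Suc k))) ** ?A **
          horn_G1 (A + mat (of_nat (Suc k))) B B' (\<alpha> * z) (\<beta> * z)"
        unfolding cscale_mult_right[symmetric] D(2) add_mat_of_nat_Suc by (simp only: matrix_mul_assoc)
      also have "\<dots> = F (Suc k) z"
        unfolding F_def comm[symmetric] mpoch.simps by (simp only: matrix_mul_assoc)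
      finally show ?thesis .
    qed
    ultimately show ?thesis by blast
  qed
  show "(\<lambda>w. mpow w A ** horn_G1 A B B' (\<alpha> * w) (\<beta> * w)) mholomorphic_on ?S"
    unfolding F0[symmetric] using step by (intro mholomorphic_onI) blast
  have open_S: "open ?S"
  proof -
    have "?S = - \<real>\<^sub>\<le>\<^sub>0 \<inter> {w. norm (\<alpha> * w) + norm (\<beta> * w) < 1}" by (auto simp: G1_domain_def)
    also have "open \<dots>"
      by (intro open_Int open_Collect_less continuous_intros) (simp add: open_Compl)
    finally show ?thesis .
  qed
  show "(sq_mderiv ^^ r) (\<lambda>w. mpow w A ** horn_G1 A B B' (\<alpha> * w) (\<beta> * w)) z =
      mpow z (A + mat (of_nat r)) ** mpoch A r ** horn_G1 (A + mat (of_nat r)) B B' (\<alpha> * z) (\<beta> * z)"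
    if "z \<notin> \<real>\<^sub>\<le>\<^sub>0" "(\<alpha> * z, \<beta> * z) \<in> G1_domain"
    unfolding F0[symmetric] sq_mderiv_power F_def[symmetric]
    by (rule iterate_mderiv[OF open_S, of z r F "\<lambda>z. z\<^sup>2"]) (use that step in auto)
qed

lemma weighted_horn_G1_B'_derivatives:
  fixes A B B' :: "complex^'d^'d"
  assumes "nonresonant B" "nonresonant B'" "nonresonant (B' + mat (of_nat r))" "r \<ge> 1"
  shows "(\<lambda>w. horn_G1 A B B' w (y / w) ** mpow w B')
      mholomorphic_on {w. w \<notin> \<real>\<^sub>\<le>\<^sub>0 \<and> (w, y / w) \<in> G1_domain}"
    and "z \<notin> \<real>\<^sub>\<le>\<^sub>0 \<Longrightarrow> (z, y / z) \<in> G1_domain \<Longrightarrow>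
      (sq_mderiv ^^ r) (\<lambda>w. horn_G1 A B B' w (y / w) ** mpow w B') z =
      horn_G1 A B (B' + mat (of_nat r)) z (y / z) ** mpow z (B' + mat (of_nat r)) ** mpoch B' r"
proof -
  let ?S = "{w. w \<notin> \<real>\<^sub>\<le>\<^sub>0 \<and> (w, y / w) \<in> G1_domain}"
  define F where "F k w = horn_G1 A B (B' + mat (of_nat k)) w (y / w) **
      mpow w (B' + mat (of_nat k)) ** mpoch B' k" for k w
  have F0: "F 0 = (\<lambda>w. horn_G1 A B B' w (y / w) ** mpow w B')"
    by (simp add: F_def fun_eq_iff)
  have step: "\<exists>D. has_mderiv (F k) D z \<and> z\<^sup>2 \<odot> D = F (Suc k) z" if "k < r" "z \<in> ?S" for k z
  proof -
    let ?B' = "B' + mat (of_nat k)"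
    have "nonresonant ?B'" "nonresonant (?B' + mat 1)"
      using nonresonant_between[OF assms(3), of k] nonresonant_between[OF assms(3), of "Suc k"] that(1)
      by (simp_all only: add_mat_of_nat_Suc)
    from weighted_horn_G1_B'_deriv[OF assms(1) this, of z y A] that(2)
    obtain D where D: "has_mderiv (\<lambda>w. horn_G1 A B ?B' w (y / w) ** mpow w ?B') D z"
        "z\<^sup>2 \<odot> D = horn_G1 A B (?B' + mat 1) z (y / z) ** mpow z (?B' + mat 1) ** ?B'"
      by auto
    have "has_mderiv (F k) (D ** mpoch B' k) z"
      using has_mderiv_cmult_right[OF D(1)] unfolding F_def by simp
    moreover have "z\<^sup>2 \<odot> (D ** mpoch B' k) = F (Suc k) z"
    proof -
      have comm: "?B' ** mpoch B' k = mpoch B' k ** ?B'"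
        by (intro commute_mpoch commute_add_mat[symmetric] refl)
      have "z\<^sup>2 \<odot> (D ** mpoch B' k) = horn_G1 A B (?B' + mat 1) z (y / z) ** mpow z (?B' + mat 1) **
          (?B' ** mpoch B' k)"
        unfolding cscale_mult_left[symmetric] D(2) by (simp only: matrix_mul_assoc)
      then show ?thesis by (simp only: comm F_def mpoch.simps add_mat_of_nat_Suc)
    qed
    ultimately show ?thesis by blast
  qed
  show "(\<lambda>w. horn_G1 A B B' w (y / w) ** mpow w B') mholomorphic_on ?S"
    unfolding F0[symmetric] using step[of 0] \<open>r \<ge> 1\<close> by (intro mholomorphic_onI) fastforce
  have open_S: "open ?S"
  proof -
    have "?S = - \<real>\<^sub>\<le>\<^sub>0 \<inter> (\<lambda>w. norm w + norm (y / w)) -` {..<1}" by (auto simp: G1_domain_def)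
    also have "open \<dots>"
      by (intro continuous_open_preimage) (auto intro!: continuous_intros simp: open_Compl)
    finally show ?thesis .
  qed
  show "(sq_mderiv ^^ r) (\<lambda>w. horn_G1 A B B' w (y / w) ** mpow w B') z =
      horn_G1 A B (B' + mat (of_nat r)) z (y / z) ** mpow z (B' + mat (of_nat r)) ** mpoch B' r"
    if "z \<notin> \<real>\<^sub>\<le>\<^sub>0" "(z, y / z) \<in> G1_domain"
    unfolding F0[symmetric] sq_mderiv_power F_def[symmetric]
    by (rule iterate_mderiv[OF open_S, of z r F "\<lambda>z. z\<^sup>2"]) (use that step in auto)
qed

text \<open>
  Exchanging the summation indices exchanges the two symbols of \<open>B\<close> and \<open>B'\<close>, whose order in the
  product matters unless they commute.
\<close>
lemma horn_G1_swap:
  fixes A B B' :: "complex^'d^'d"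
  assumes "B ** B' = B' ** B" "nonresonant B" "nonresonant B'"
  shows "horn_G1 A B B' x y = horn_G1 A B' B y x"
proof -
  have "mpoch_int B k ** mpoch_int B' l = mpoch_int B' l ** mpoch_int B k" for k l
    by (intro commute_mpoch_int assms) (rule commute_mpoch_int[OF assms(2), symmetric], simp add: assms(1))
  then have coeff: "horn_coeff A B B' (m, n) = horn_coeff A B' B (n, m)" for m n
    by (simp add: horn_coeff_def matrix_mul_assoc[symmetric] add.commute mult.commute)
  have "horn_G1 A B B' x y = (\<Sum>\<^sub>\<infinity>k. (y ^ fst k * x ^ snd k) \<odot> horn_coeff A B' B k)"
    unfolding horn_G1_eq_dseries dseries_def
    by (rule infsum_reindex_bij_witness[of _ prod.swap prod.swap])
       (auto simp: coeff mult.commute)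
  then show ?thesis by (simp add: horn_G1_eq_dseries dseries_def)
qed

lemma G1_defined_iff: "G1_defined B B' \<longleftrightarrow> nonresonant B \<and> nonresonant B'"
  by (auto simp: G1_defined_def nonresonant_def)

lemma G1_domain_swap: "(x, y) \<in> G1_domain \<longleftrightarrow> (y, x) \<in> G1_domain"
  by (auto simp: G1_domain_def)

theorem theorem4p1:
  fixes A B B' :: "complex^'d^'d" and r :: nat
  assumes "r \<ge> 1"
  shows
    "(B ** B' = B' ** B \<and> G1_defined B B' \<and>
       G1_defined (B - mat (of_nat r)) (B' + mat (of_nat r)) \<longrightarrow>
       (\<forall>y. (\<lambda>x. horn_G1 A B B' x y) mholomorphic_on {x. (x, y) \<in> G1_domain} \<and>
         (\<forall>x. (x, y) \<in> G1_domain \<longrightarrow>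
           (mderiv ^^ r) (\<lambda>x. horn_G1 A B B' x y) x =
           (- 1) ^ r \<odot> (mpoch A r **
             horn_G1 (A + mat (of_nat r)) (B - mat (of_nat r)) (B' + mat (of_nat r)) x y **
             matrix_inv (mpoch (mat 1 - B) r) ** mpoch B' r)))) \<and>
     (B ** B' = B' ** B \<and> G1_defined B B' \<and>
       G1_defined (B + mat (of_nat r)) (B' - mat (of_nat r)) \<longrightarrow>
       (\<forall>x. (\<lambda>y. horn_G1 A B B' x y) mholomorphic_on {y. (x, y) \<in> G1_domain} \<and>
         (\<forall>y. (x, y) \<in> G1_domain \<longrightarrow>
           (mderiv ^^ r) (\<lambda>y. horn_G1 A B B' x y) y =
           (- 1) ^ r \<odot> (mpoch A r **
             horn_G1 (A + mat (of_nat r)) (B + mat (of_nat r)) (B' - mat (of_nat r)) x y **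
             mpoch B r ** matrix_inv (mpoch (mat 1 - B') r))))) \<and>
     (G1_defined B B' \<longrightarrow>
       (\<forall>y. (\<lambda>x. mpow x A ** horn_G1 A B B' x (x * y))
           mholomorphic_on {x. x \<notin> \<real>\<^sub>\<le>\<^sub>0 \<and> (x, x * y) \<in> G1_domain} \<and>
         (\<forall>x. x \<notin> \<real>\<^sub>\<le>\<^sub>0 \<and> (x, x * y) \<in> G1_domain \<longrightarrow>
           (sq_mderiv ^^ r) (\<lambda>x. mpow x A ** horn_G1 A B B' x (x * y)) x =
           mpow x (A + mat (of_nat r)) ** mpoch A r **
             horn_G1 (A + mat (of_nat r)) B B' x (x * y)))) \<and>
     (G1_defined B B' \<longrightarrow>
       (\<forall>x. (\<lambda>y. mpow y A ** horn_G1 A B B' (x * y) y)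
           mholomorphic_on {y. y \<notin> \<real>\<^sub>\<le>\<^sub>0 \<and> (x * y, y) \<in> G1_domain} \<and>
         (\<forall>y. y \<notin> \<real>\<^sub>\<le>\<^sub>0 \<and> (x * y, y) \<in> G1_domain \<longrightarrow>
           (sq_mderiv ^^ r) (\<lambda>y. mpow y A ** horn_G1 A B B' (x * y) y) y =
           mpow y (A + mat (of_nat r)) ** mpoch A r **
             horn_G1 (A + mat (of_nat r)) B B' (x * y) y))) \<and>
     (G1_defined B B' \<and> G1_defined B (B' + mat (of_nat r)) \<longrightarrow>
       (\<forall>y. (\<lambda>x. horn_G1 A B B' x (y / x) ** mpow x B')
           mholomorphic_on {x. x \<notin> \<real>\<^sub>\<le>\<^sub>0 \<and> (x, y / x) \<in> G1_domain} \<and>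
         (\<forall>x. x \<notin> \<real>\<^sub>\<le>\<^sub>0 \<and> (x, y / x) \<in> G1_domain \<longrightarrow>
           (sq_mderiv ^^ r) (\<lambda>x. horn_G1 A B B' x (y / x) ** mpow x B') x =
           horn_G1 A B (B' + mat (of_nat r)) x (y / x) **
             mpow x (B' + mat (of_nat r)) ** mpoch B' r))) \<and>
     (B ** B' = B' ** B \<and> G1_defined B B' \<and> G1_defined (B + mat (of_nat r)) B' \<longrightarrow>
       (\<forall>x. (\<lambda>y. horn_G1 A B B' (x / y) y ** mpow y B)
           mholomorphic_on {y. y \<notin> \<real>\<^sub>\<le>\<^sub>0 \<and> (x / y, y) \<in> G1_domain} \<and>
         (\<forall>y. y \<notin> \<real>\<^sub>\<le>\<^sub>0 \<and> (x / y, y) \<in> G1_domain \<longrightarrow>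
           (sq_mderiv ^^ r) (\<lambda>y. horn_G1 A B B' (x / y) y ** mpow y B) y =
           horn_G1 A (B + mat (of_nat r)) B' (x / y) y **
             mpow y (B + mat (of_nat r)) ** mpoch B r)))"
proof (intro conjI impI; (elim conjE)?)
  assume comm: "B ** B' = B' ** B" and def: "G1_defined B B'"
    "G1_defined (B - mat (of_nat r)) (B' + mat (of_nat r))"
  then have nr: "nonresonant B" "nonresonant B'" "nonresonant (B' + mat (of_nat r))"
    by (simp_all add: G1_defined_iff)
  show "\<forall>y. (\<lambda>x. horn_G1 A B B' x y) mholomorphic_on {x. (x, y) \<in> G1_domain} \<and>
         (\<forall>x. (x, y) \<in> G1_domain \<longrightarrow>
           (mderiv ^^ r) (\<lambda>x. horn_G1 A B B' x y) x =
           (- 1) ^ r \<odot> (mpoch A r **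
             horn_G1 (A + mat (of_nat r)) (B - mat (of_nat r)) (B' + mat (of_nat r)) x y **
             matrix_inv (mpoch (mat 1 - B) r) ** mpoch B' r))"
    using horn_G1_x_derivatives[OF comm nr assms, where A = A] by blast
next
  assume comm: "B ** B' = B' ** B" and def: "G1_defined B B'"
    "G1_defined (B + mat (of_nat r)) (B' - mat (of_nat r))"
  then have nr: "nonresonant B" "nonresonant B'" "nonresonant (B + mat (of_nat r))"
      "nonresonant (B' - mat (of_nat r))"
    by (simp_all add: G1_defined_iff)
  have comm_r: "(B + mat (of_nat r)) ** (B' - mat (of_nat r)) = (B' - mat (of_nat r)) ** (B + mat (of_nat r))"
    unfolding diff_mat by (rule commute_add_mats[OF comm])
  have poch_comm: "mpoch B r ** matrix_inv (mpoch (mat 1 - B') r) =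
      matrix_inv (mpoch (mat 1 - B') r) ** mpoch B r"
    using nr(2) unfolding nonresonant_def
    by (intro commute_matrix_inv commute_mpoch commute_mat_diff commute_mpoch[symmetric]) (auto simp: comm)
  show "\<forall>x. (\<lambda>y. horn_G1 A B B' x y) mholomorphic_on {y. (x, y) \<in> G1_domain} \<and>
         (\<forall>y. (x, y) \<in> G1_domain \<longrightarrow>
           (mderiv ^^ r) (\<lambda>y. horn_G1 A B B' x y) y =
           (- 1) ^ r \<odot> (mpoch A r **
             horn_G1 (A + mat (of_nat r)) (B + mat (of_nat r)) (B' - mat (of_nat r)) x y **
             mpoch B r ** matrix_inv (mpoch (mat 1 - B') r)))"
  proof (intro allI conjI impI)
    fix x y
    have swap: "horn_G1 A B B' x = (\<lambda>y. horn_G1 A B' B y x)"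
      using horn_G1_swap[OF comm nr(1,2)] by (simp add: fun_eq_iff)
    note deriv = horn_G1_x_derivatives[OF comm[symmetric] nr(2,1,3) assms, where A = A]
    show "(\<lambda>y. horn_G1 A B B' x y) mholomorphic_on {y. (x, y) \<in> G1_domain}"
      unfolding swap G1_domain_swap[of x] by (rule deriv(1))
    assume "(x, y) \<in> G1_domain"
    then have "(y, x) \<in> G1_domain" by (simp add: G1_domain_swap[of x])
    from deriv(2)[OF this]
    show "(mderiv ^^ r) (\<lambda>y. horn_G1 A B B' x y) y =
           (- 1) ^ r \<odot> (mpoch A r **
             horn_G1 (A + mat (of_nat r)) (B + mat (of_nat r)) (B' - mat (of_nat r)) x y **
             mpoch B r ** matrix_inv (mpoch (mat 1 - B') r))"
      unfolding swap horn_G1_swap[OF comm_r nr(3,4)]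
      by (simp only: matrix_mul_assoc[symmetric] poch_comm)
  qed
next
  assume "G1_defined B B'"
  then have nr: "nonresonant B" "nonresonant B'" by (simp_all add: G1_defined_iff)
  show "\<forall>y. (\<lambda>x. mpow x A ** horn_G1 A B B' x (x * y))
           mholomorphic_on {x. x \<notin> \<real>\<^sub>\<le>\<^sub>0 \<and> (x, x * y) \<in> G1_domain} \<and>
         (\<forall>x. x \<notin> \<real>\<^sub>\<le>\<^sub>0 \<and> (x, x * y) \<in> G1_domain \<longrightarrow>
           (sq_mderiv ^^ r) (\<lambda>x. mpow x A ** horn_G1 A B B' x (x * y)) x =
           mpow x (A + mat (of_nat r)) ** mpoch A r **
             horn_G1 (A + mat (of_nat r)) B B' x (x * y))"
    using weighted_horn_G1_A_derivatives[OF nr, where A = A and \<alpha> = 1] by (simp add: mult.commute)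
next
  assume "G1_defined B B'"
  then have nr: "nonresonant B" "nonresonant B'" by (simp_all add: G1_defined_iff)
  show "\<forall>x. (\<lambda>y. mpow y A ** horn_G1 A B B' (x * y) y)
           mholomorphic_on {y. y \<notin> \<real>\<^sub>\<le>\<^sub>0 \<and> (x * y, y) \<in> G1_domain} \<and>
         (\<forall>y. y \<notin> \<real>\<^sub>\<le>\<^sub>0 \<and> (x * y, y) \<in> G1_domain \<longrightarrow>
           (sq_mderiv ^^ r) (\<lambda>y. mpow y A ** horn_G1 A B B' (x * y) y) y =
           mpow y (A + mat (of_nat r)) ** mpoch A r **
             horn_G1 (A + mat (of_nat r)) B B' (x * y) y)"
    using weighted_horn_G1_A_derivatives[OF nr, where A = A and \<beta> = 1] by simp
next
  assume "G1_defined B B'" "G1_defined B (B' + mat (of_nat r))"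
  then have nr: "nonresonant B" "nonresonant B'" "nonresonant (B' + mat (of_nat r))"
    by (simp_all add: G1_defined_iff)
  show "\<forall>y. (\<lambda>x. horn_G1 A B B' x (y / x) ** mpow x B')
           mholomorphic_on {x. x \<notin> \<real>\<^sub>\<le>\<^sub>0 \<and> (x, y / x) \<in> G1_domain} \<and>
         (\<forall>x. x \<notin> \<real>\<^sub>\<le>\<^sub>0 \<and> (x, y / x) \<in> G1_domain \<longrightarrow>
           (sq_mderiv ^^ r) (\<lambda>x. horn_G1 A B B' x (y / x) ** mpow x B') x =
           horn_G1 A B (B' + mat (of_nat r)) x (y / x) **
             mpow x (B' + mat (of_nat r)) ** mpoch B' r)"
    using weighted_horn_G1_B'_derivatives[OF nr assms] by simp
next
  assume comm: "B ** B' = B' ** B" and "G1_defined B B'" "G1_defined (B + mat (of_nat r)) B'"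
  then have nr: "nonresonant B" "nonresonant B'" "nonresonant (B + mat (of_nat r))"
    by (simp_all add: G1_defined_iff)
  have comm_r: "(B + mat (of_nat r)) ** B' = B' ** (B + mat (of_nat r))"
    using commute_add_mat[OF comm[symmetric]] by simp
  show "\<forall>x. (\<lambda>y. horn_G1 A B B' (x / y) y ** mpow y B)
           mholomorphic_on {y. y \<notin> \<real>\<^sub>\<le>\<^sub>0 \<and> (x / y, y) \<in> G1_domain} \<and>
         (\<forall>y. y \<notin> \<real>\<^sub>\<le>\<^sub>0 \<and> (x / y, y) \<in> G1_domain \<longrightarrow>
           (sq_mderiv ^^ r) (\<lambda>y. horn_G1 A B B' (x / y) y ** mpow y B) y =
           horn_G1 A (B + mat (of_nat r)) B' (x / y) y **
             mpow y (B + mat (of_nat r)) ** mpoch B r)"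
    unfolding horn_G1_swap[OF comm nr(1,2)] horn_G1_swap[OF comm_r nr(3,2)] G1_domain_swap[of "_ / _"]
    using weighted_horn_G1_B'_derivatives[OF nr(2,1,3) assms] by simp
qed

end
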